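(* Let $n\ge2$ and let $\mathcal{Q}=\mathcal{Q}_1\otimes\cdots\otimes\mathcal{Q}_n$ be a doubly commuting quotient module of $H^2(\mathbb{D}^n)$, where each $\mathcal{Q}_i$ is a quotient module of $H^2(\mathbb{D})$. Then $\mathcal{Q}$ is essentially normal if and only if one of the following holds: (i) $\mathcal{Q}$ is finite dimensional. (ii) There exists $i\in\{1,\dots,n\}$ such that $\mathcal{Q}_i$ is infinite dimensional, and $\mathcal{Q}_j\cong\mathbb{C}$ (i.e. $\dim\mathcal{Q}_j=1$) for all $j\ne i$.
   Context: $H^2(\mathbb{D}^n)=H^2(\mathbb{D})\otimes\cdots\otimes H^2(\mathbb{D})$ is the Hardy space over the open unit polydisc, with coordinate multiplication operators $M_{z_i}$. A quotient module is a closed subspace $\mathcal{Q}$ whose orthogonal complement is invariant under all $M_{z_i}$; put $C_{z_i}=P_{\mathcal{Q}}M_{z_i}|_{\mathcal{Q}}$. $\mathcal{Q}$ is doubly commuting if $[C_{z_i},C_{z_j}^*]=0$ for all $1\le i<j\le n$, which is known to be equivalent to $\mathcal{Q}=\mathcal{Q}_1\otimes\cdots\otimes\mathcal{Q}_n$ with $\mathcal{Q}_i$ quotient modules of $H^2(\mathbb{D})$. $\mathcal{Q}$ is essentially normal if $[C_{z_i},C_{z_j}^*]$ is compact for all $1\le i,j\le n$. *)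

theory Defs
  imports "HOL-Analysis.Analysis" "HOL-Library.Function_Algebras"
begin

section \<open>The complex vector space of functions\<close>

definition cscale :: "complex \<Rightarrow> ('a \<Rightarrow> complex) \<Rightarrow> 'a \<Rightarrow> complex" where
  "cscale c f = (\<lambda>x. c * f x)"

global_interpretation cfun: vector_space cscale
  by unfold_locales (auto simp: cscale_def fun_eq_iff algebra_simps)

definition finite_dim :: "('a \<Rightarrow> complex) set \<Rightarrow> bool" where
  "finite_dim V \<longleftrightarrow> (\<exists>B. finite B \<and> V \<subseteq> cfun.span B)"


section \<open>The Hardy space over the polydisc\<close>

text \<open>
  Points of the ambient n-dimensional complex space are vectors of type \<^typ>\<open>complex ^ 'n\<close>;
  the one-variable Hardy space is the instance \<^typ>\<open>complex ^ 1\<close>. Multi-indices are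
  functions of type \<^typ>\<open>'n \<Rightarrow> nat\<close>.
\<close>

definition polydisc :: "(complex ^ 'n) set" where
  "polydisc = {z. \<forall>i. cmod (z $ i) < 1}"

definition has_power_series ::
    "(complex ^ 'n \<Rightarrow> complex) \<Rightarrow> (('n \<Rightarrow> nat) \<Rightarrow> complex) \<Rightarrow> bool" where
  "has_power_series f a \<longleftrightarrow>
     (\<forall>z\<in>polydisc. ((\<lambda>k. a k * (\<Prod>i\<in>UNIV. (z $ i) ^ k i)) has_sum f z) UNIV)"

text \<open>
  The Hardy space: the holomorphic functions on the open polydisc with square-summable
  Taylor coefficients. As functions are total here, an element is made to vanish outside the
  polydisc, so that equality in the Hardy space is equality of functions.
\<close>

definition hardy :: "(complex ^ 'n \<Rightarrow> complex) set" where
  "hardy = {f. (\<exists>a. has_power_series f a \<and> (\<lambda>k. (cmod (a k))\<^sup>2) summable_on UNIV)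
               \<and> (\<forall>z. z \<notin> polydisc \<longrightarrow> f z = 0)}"

text \<open>The coefficients are determined by the function, by the identity theorem for power series.\<close>

definition taylor_coeff :: "(complex ^ 'n \<Rightarrow> complex) \<Rightarrow> ('n \<Rightarrow> nat) \<Rightarrow> complex" where
  "taylor_coeff f = (THE a. has_power_series f a)"

definition hinner :: "(complex ^ 'n \<Rightarrow> complex) \<Rightarrow> (complex ^ 'n \<Rightarrow> complex) \<Rightarrow> complex" where
  "hinner f g = (\<Sum>\<^sub>\<infinity>k. taylor_coeff f k * cnj (taylor_coeff g k))"

definition hnorm :: "(complex ^ 'n \<Rightarrow> complex) \<Rightarrow> real" where
  "hnorm f = sqrt (Re (hinner f f))"

definition hardy_topology :: "(complex ^ 'n \<Rightarrow> complex) topology" where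
  "hardy_topology = Metric_space.mtopology hardy (\<lambda>f g. hnorm (f - g))"

definition mult_op :: "'n \<Rightarrow> (complex ^ 'n \<Rightarrow> complex) \<Rightarrow> (complex ^ 'n \<Rightarrow> complex)" where
  "mult_op i f = (\<lambda>z. z $ i * f z)"

definition orth_compl :: "(complex ^ 'n \<Rightarrow> complex) set \<Rightarrow> (complex ^ 'n \<Rightarrow> complex) set" where
  "orth_compl V = {f \<in> hardy. \<forall>g\<in>V. hinner f g = 0}"


section \<open>Operators on closed subspaces\<close>

text \<open>
  Operators on a closed subspace \<open>Q\<close> are represented by functions on the whole function type,
  of which only the values on \<open>Q\<close> are meaningful.
\<close>

definition proj :: "(complex ^ 'n \<Rightarrow> complex) set
    \<Rightarrow> (complex ^ 'n \<Rightarrow> complex) \<Rightarrow> (complex ^ 'n \<Rightarrow> complex)" where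
  "proj Q f = (THE g. g \<in> Q \<and> f - g \<in> orth_compl Q)"

definition adj_on :: "(complex ^ 'n \<Rightarrow> complex) set
    \<Rightarrow> ((complex ^ 'n \<Rightarrow> complex) \<Rightarrow> (complex ^ 'n \<Rightarrow> complex))
    \<Rightarrow> (complex ^ 'n \<Rightarrow> complex) \<Rightarrow> (complex ^ 'n \<Rightarrow> complex)" where
  "adj_on Q T g = (THE h. h \<in> Q \<and> (\<forall>f\<in>Q. hinner (T f) g = hinner f h))"

definition commutator :: "(('a \<Rightarrow> complex) \<Rightarrow> ('a \<Rightarrow> complex))
    \<Rightarrow> (('a \<Rightarrow> complex) \<Rightarrow> ('a \<Rightarrow> complex)) \<Rightarrow> ('a \<Rightarrow> complex) \<Rightarrow> ('a \<Rightarrow> complex)" where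
  "commutator S T f = S (T f) - T (S f)"

definition compact_op_on :: "(complex ^ 'n \<Rightarrow> complex) set
    \<Rightarrow> ((complex ^ 'n \<Rightarrow> complex) \<Rightarrow> (complex ^ 'n \<Rightarrow> complex)) \<Rightarrow> bool" where
  "compact_op_on Q T \<longleftrightarrow>
     compactin hardy_topology (hardy_topology closure_of (T ` {f \<in> Q. hnorm f \<le> 1}))"


section \<open>Quotient modules\<close>

definition quotient_module :: "(complex ^ 'n \<Rightarrow> complex) set \<Rightarrow> bool" where
  "quotient_module Q \<longleftrightarrow>
     Q \<subseteq> hardy \<and> cfun.subspace Q \<and> closedin hardy_topology Q \<and>
     (\<forall>i. mult_op i ` orth_compl Q \<subseteq> orth_compl Q)"

definition compression :: "(complex ^ 'n \<Rightarrow> complex) set \<Rightarrow> 'n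
    \<Rightarrow> (complex ^ 'n \<Rightarrow> complex) \<Rightarrow> (complex ^ 'n \<Rightarrow> complex)" where
  "compression Q i f = proj Q (mult_op i f)"

definition doubly_commuting :: "(complex ^ 'n::{finite,linorder} \<Rightarrow> complex) set \<Rightarrow> bool" where
  "doubly_commuting Q \<longleftrightarrow>
     (\<forall>i j. i < j \<longrightarrow>
        (\<forall>f\<in>Q. commutator (compression Q i) (adj_on Q (compression Q j)) f = 0))"

definition essentially_normal :: "(complex ^ 'n \<Rightarrow> complex) set \<Rightarrow> bool" where
  "essentially_normal Q \<longleftrightarrow>
     (\<forall>i j. compact_op_on Q (commutator (compression Q i) (adj_on Q (compression Q j))))"


section \<open>Tensor products\<close>

text \<open>
  Under the identification of the Hardy space over the polydisc with the Hilbert space tensor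
  product of one-variable Hardy spaces, an elementary tensor is the product of one-variable
  functions in separate variables. The tensor product of closed subspaces is the closed linear
  span of the elementary tensors.
\<close>

definition elem_tensor :: "('n \<Rightarrow> complex ^ 1 \<Rightarrow> complex) \<Rightarrow> complex ^ 'n \<Rightarrow> complex" where
  "elem_tensor f = (\<lambda>z. \<Prod>i\<in>UNIV. f i (vec (z $ i)))"

definition tensor_space :: "('n \<Rightarrow> (complex ^ 1 \<Rightarrow> complex) set)
    \<Rightarrow> (complex ^ 'n \<Rightarrow> complex) set" where
  "tensor_space Q =
     hardy_topology closure_of (cfun.span {elem_tensor f |f. \<forall>i. f i \<in> Q i})"

end

theory Submission
  imports Defs "HOL-Complex_Analysis.Cauchy_Integral_Formula"
begin

text \<open>
  Taylor coefficients identify the Hardy space with \<open>\<ell>\<^sup>2\<close>. The adjoint of the compression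
  \<open>C\<^sub>i\<close> is the backward shift, and \<open>[C\<^sub>i, C\<^sub>i\<^sup>*]\<close> acts on elementary tensors as the one-variable
  self-commutator of \<open>Q\<^sub>i\<close> in the \<open>i\<close>-th factor and as the identity in the others; the mixed
  commutators vanish. The one-variable self-commutator has rank at most two, because the
  wandering subspace of \<open>Q\<^sub>i\<^sup>\<bottom>\<close> has dimension at most one, and it vanishes only if
  \<open>dim Q\<^sub>i \<le> 1\<close>. If it is nonzero at some \<open>g\<close> while another factor is infinite-dimensional, tensoring
  \<open>g\<close> with an orthonormal sequence of that factor contradicts compactness.
\<close>

section \<open>Square-summable families\<close>

text \<open>In one variable let \<open>S\<close> be the shift and \<open>P\<close> the projection
  onto the quotient module. Since \<open>S S*\<close> is the identity minus the projection onto the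
  constants, \<open>[C, C*] x = S* (I - P) S x - x(0) P e0\<close>. The defect
  \<open>(I - P) S x\<close> lies in the wandering subspace of the complement, so each summand
  contributes at most one dimension. Beurling's theorem is bypassed: commutativity of the product of
  power series already forbids two nonzero orthogonal vectors in the wandering subspace. The
  compactness argument needs a nonzero vector in every factor. A zero factor makes the whole tensor
  product zero, hence finite-dimensional, so case (i) absorbs it. Double commutation enters through
  the mixed commutators: it is assumed for \<open>i < j\<close>, and passing to adjoints covers
  \<open>i > j\<close>.\<close>

definition square_summable :: "('a \<Rightarrow> complex) \<Rightarrow> bool" where
  "square_summable x \<longleftrightarrow> (\<lambda>k. (cmod (x k))\<^sup>2) summable_on UNIV"

lemma square_summable_mult_summable:
  assumes "square_summable x" "square_summable y"
  shows "(\<lambda>k. norm (x k * cnj (y k))) summable_on UNIV"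
proof (rule Infinite_Sum.abs_summable_on_comparison_test')
  show "(\<lambda>k. (cmod (x k))\<^sup>2 + (cmod (y k))\<^sup>2) summable_on UNIV"
    using assms by (simp add: square_summable_def summable_on_add)
  show "norm (x k * cnj (y k)) \<le> (cmod (x k))\<^sup>2 + (cmod (y k))\<^sup>2" for k
    using sum_squares_bound[of "cmod (x k)" "cmod (y k)"]
      mult_nonneg_nonneg[OF norm_ge_zero[of "x k"] norm_ge_zero[of "y k"]]
    unfolding norm_mult complex_mod_cnj by linarith
qed

lemma square_summable_add:
  assumes "square_summable x" "square_summable y"
  shows "square_summable (\<lambda>k. x k + y k)"
  unfolding square_summable_def
proof (rule summable_on_comparison_test)
  show "(\<lambda>k. 2 * ((cmod (x k))\<^sup>2 + (cmod (y k))\<^sup>2)) summable_on UNIV"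
    using assms by (intro summable_on_cmult_right) (simp add: square_summable_def summable_on_add)
  show "(cmod (x k + y k))\<^sup>2 \<le> 2 * ((cmod (x k))\<^sup>2 + (cmod (y k))\<^sup>2)" for k
  proof -
    have "(cmod (x k + y k))\<^sup>2 \<le> (cmod (x k) + cmod (y k))\<^sup>2"
      by (simp add: norm_triangle_ineq power_mono)
    also have "\<dots> \<le> 2 * ((cmod (x k))\<^sup>2 + (cmod (y k))\<^sup>2)"
      using sum_squares_bound[of "cmod (x k)" "cmod (y k)"] by (simp add: power2_sum)
    finally show ?thesis .
  qed
qed auto

lemma square_summable_mult:
  assumes "square_summable x"
  shows "square_summable (\<lambda>k. c * x k)"
  using assms by (simp add: square_summable_def norm_mult power_mult_distrib summable_on_cmult_right)

text \<open>A type rather than a carrier set, so that norm, topology, completeness and compactness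
  come from the classes \<open>real_inner\<close> and \<open>banach\<close>. These are real
  structures; \<open>scaleC\<close> and \<open>cinner\<close> carry the complex one
  alongside.\<close>

typedef 'a ell2 = "{x :: 'a \<Rightarrow> complex. square_summable x}"
  morphisms coef Abs_ell2
proof
  show "(\<lambda>_. 0) \<in> {x :: 'a \<Rightarrow> complex. square_summable x}"
    by (simp add: square_summable_def)
qed

setup_lifting type_definition_ell2

lemma square_summable_coef: "square_summable (coef x)"
  using coef by blast

lemma ell2_eqI: "(\<And>k. coef x k = coef y k) \<Longrightarrow> x = y"
  by (simp add: coef_inject[symmetric] fun_eq_iff)

instantiation ell2 :: (type) real_vector
begin

lift_definition zero_ell2 :: "'a ell2" is "\<lambda>_. 0"
  by (simp add: square_summable_def)

lift_definition plus_ell2 :: "'a ell2 \<Rightarrow> 'a ell2 \<Rightarrow> 'a ell2" is "\<lambda>x y k. x k + y k"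
  by (rule square_summable_add)

lift_definition uminus_ell2 :: "'a ell2 \<Rightarrow> 'a ell2" is "\<lambda>x k. - x k"
  by (simp add: square_summable_def)

lift_definition minus_ell2 :: "'a ell2 \<Rightarrow> 'a ell2 \<Rightarrow> 'a ell2" is "\<lambda>x y k. x k - y k"
  using square_summable_add square_summable_mult[of _ "-1"] by fastforce

lift_definition scaleR_ell2 :: "real \<Rightarrow> 'a ell2 \<Rightarrow> 'a ell2" is "\<lambda>r x k. of_real r * x k"
  by (rule square_summable_mult)

instance
  by standard (transfer; simp add: fun_eq_iff algebra_simps)+

end

lift_definition scaleC :: "complex \<Rightarrow> 'a ell2 \<Rightarrow> 'a ell2" (infixr "*\<^sub>C" 75) is "\<lambda>c x k. c * x k"
  by (rule square_summable_mult)

lemma coef_simps [simp]: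
  "coef 0 k = 0" "coef (x + y) k = coef x k + coef y k" "coef (- x) k = - coef x k"
  "coef (x - y) k = coef x k - coef y k" "coef (r *\<^sub>R x) k = of_real r * coef x k"
  "coef (c *\<^sub>C x) k = c * coef x k"
  by (transfer; simp)+

lemma coef_sum [simp]: "coef (sum f A) k = (\<Sum>i\<in>A. coef (f i) k)"
  by (induction A rule: infinite_finite_induct) auto

section \<open>The complex inner product and the real Hilbert space structure\<close>

definition cinner :: "'a ell2 \<Rightarrow> 'a ell2 \<Rightarrow> complex" where
  "cinner x y = (\<Sum>\<^sub>\<infinity>k. coef x k * cnj (coef y k))"

lemma cinner_abs_summable: "(\<lambda>k. norm (coef x k * cnj (coef y k))) summable_on UNIV"
  by (rule square_summable_mult_summable[OF square_summable_coef square_summable_coef])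

lemma cinner_summable: "(\<lambda>k. coef x k * cnj (coef y k)) summable_on UNIV"
  by (rule abs_summable_summable[OF cinner_abs_summable])

lemma cinner_has_sum: "((\<lambda>k. coef x k * cnj (coef y k)) has_sum cinner x y) UNIV"
  unfolding cinner_def by (rule has_sum_infsum[OF cinner_summable])

lemma cinner_add_left: "cinner (x + y) z = cinner x z + cinner y z"
  unfolding cinner_def
  by (simp add: distrib_right infsum_add[OF cinner_summable cinner_summable])

lemma cinner_scaleC_left: "cinner (c *\<^sub>C x) y = c * cinner x y"
  by (simp add: cinner_def mult.assoc infsum_cmult_right')

lemma cinner_commute: "cinner x y = cnj (cinner y x)"
  by (simp add: cinner_def flip: infsum_cnj) (simp add: mult.commute)

lemma scaleR_scaleC: "r *\<^sub>R (x :: 'a ell2) = of_real r *\<^sub>C x"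
  by (rule ell2_eqI) simp

lemma cinner_scaleR_left: "cinner (r *\<^sub>R x) y = of_real r * cinner x y"
  by (simp add: scaleR_scaleC cinner_scaleC_left)

lemma cinner_self_has_sum: "((\<lambda>k. (cmod (coef x k))\<^sup>2) has_sum Re (cinner x x)) UNIV"
  using has_sum_Re[OF cinner_has_sum, of x x] by (simp add: complex_mult_cnj cmod_power2)

lemma Im_cinner_self: "Im (cinner x x) = 0"
  using cinner_commute[of x x] by (simp add: complex_eq_iff)

instantiation ell2 :: (type) real_inner
begin

definition inner_ell2 :: "'a ell2 \<Rightarrow> 'a ell2 \<Rightarrow> real" where
  "inner_ell2 x y = Re (cinner x y)"

definition norm_ell2 :: "'a ell2 \<Rightarrow> real" where
  "norm_ell2 x = sqrt (Re (cinner x x))"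

definition dist_ell2 :: "'a ell2 \<Rightarrow> 'a ell2 \<Rightarrow> real" where
  "dist_ell2 x y = norm (x - y)"

definition sgn_ell2 :: "'a ell2 \<Rightarrow> 'a ell2" where
  "sgn_ell2 x = x /\<^sub>R norm x"

definition uniformity_ell2 :: "('a ell2 \<times> 'a ell2) filter" where
  "uniformity_ell2 = (INF e\<in>{0 <..}. principal {(x, y). dist x y < e})"

definition open_ell2 :: "'a ell2 set \<Rightarrow> bool" where
  "open_ell2 U \<longleftrightarrow> (\<forall>x\<in>U. eventually (\<lambda>(x', y). x' = x \<longrightarrow> y \<in> U) uniformity)"

instance
proof
  fix x y z :: "'a ell2" and r :: real
  show "inner x y = inner y x"
    unfolding inner_ell2_def by (subst cinner_commute) simp
  show "inner (x + y) z = inner x z + inner y z"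
    by (simp add: inner_ell2_def cinner_add_left)
  show "inner (r *\<^sub>R x) y = r * inner x y"
    by (simp add: inner_ell2_def cinner_scaleR_left)
  show "0 \<le> inner x x"
    using has_sum_nonneg[OF cinner_self_has_sum[of x]] by (simp add: inner_ell2_def)
  show "inner x x = 0 \<longleftrightarrow> x = 0"
  proof
    assume "inner x x = 0"
    then have "((\<lambda>k. (cmod (coef x k))\<^sup>2) has_sum 0) UNIV"
      using cinner_self_has_sum[of x] by (simp add: inner_ell2_def)
    then have "(cmod (coef x k))\<^sup>2 = 0" for k
      by (rule nonneg_has_sum_le_0D) auto
    then show "x = 0"
      by (intro ell2_eqI) simp
  qed (simp add: inner_ell2_def cinner_def)
  show "norm x = sqrt (inner x x)"
    by (simp add: norm_ell2_def inner_ell2_def)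
qed (rule dist_ell2_def sgn_ell2_def uniformity_ell2_def open_ell2_def)+

end

lemma Re_cinner: "Re (cinner x y) = inner x y"
  by (simp add: inner_ell2_def)

lemma cinner_self: "cinner x x = of_real ((norm x)\<^sup>2)"
  by (simp add: complex_eq_iff Im_cinner_self power2_norm_eq_inner inner_ell2_def)

lemma norm_has_sum: "((\<lambda>k. (cmod (coef x k))\<^sup>2) has_sum (norm x)\<^sup>2) UNIV"
  using cinner_self_has_sum[of x] by (simp add: cinner_self)

lemma cinner_add_right: "cinner x (y + z) = cinner x y + cinner x z"
  by (metis cinner_add_left cinner_commute complex_cnj_add)

lemma cinner_scaleC_right: "cinner x (c *\<^sub>C y) = cnj c * cinner x y"
  by (metis cinner_commute cinner_scaleC_left complex_cnj_mult)

lemma cinner_zero [simp]: "cinner 0 x = 0" "cinner x 0 = 0"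
  by (simp_all add: cinner_def)

lemma cinner_minus: "cinner (- x) y = - cinner x y" "cinner x (- y) = - cinner x y"
  by (simp_all add: cinner_def infsum_uminus)

lemma cinner_diff_left: "cinner (x - y) z = cinner x z - cinner y z"
  by (metis cinner_add_left cinner_minus(1) uminus_add_conv_diff add.commute)

lemma cinner_diff_right: "cinner x (y - z) = cinner x y - cinner x z"
  by (metis cinner_add_right cinner_minus(2) uminus_add_conv_diff add.commute)

lemma cinner_eq_0_commute: "cinner x y = 0 \<longleftrightarrow> cinner y x = 0"
  by (metis cinner_commute complex_cnj_zero_iff)

lemma cinner_self_eq_0 [simp]: "cinner x x = 0 \<longleftrightarrow> x = 0"
  by (simp add: cinner_self)

lemma norm_scaleC [simp]: "norm (c *\<^sub>C x) = cmod c * norm x"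
proof -
  have "complex_of_real ((norm (c *\<^sub>C x))\<^sup>2) = of_real ((cmod c * norm x)\<^sup>2)"
    by (simp only: cinner_self[symmetric] cinner_scaleC_left cinner_scaleC_right)
       (simp add: cinner_self power_mult_distrib complex_norm_square[of c] algebra_simps
          del: of_real_power flip: of_real_power[of "cmod c"])
  then have "(norm (c *\<^sub>C x))\<^sup>2 = (cmod c * norm x)\<^sup>2"
    by (simp only: of_real_eq_iff)
  then show ?thesis
    by (simp add: power2_eq_iff_nonneg)
qed

text \<open>Real orthogonality to a set closed under multiplication by the imaginary unit is
  therefore complex orthogonality. This carries the real projection theorem over to complex
  subspaces.\<close>

lemma Im_cinner: "Im (cinner x y) = Re (cinner x (\<i> *\<^sub>C y))"
  by (simp add: cinner_scaleC_right)

text \<open>A unimodular factor \<open>c\<close> on \<open>y\<close> makes the product real and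
  nonnegative, which reduces the claim to the real Cauchy-Schwarz inequality.\<close>

lemma norm_cinner_le: "cmod (cinner x y) \<le> norm x * norm y"
proof (cases "cinner x y = 0")
  case False
  define c where "c = cinner x y / of_real (cmod (cinner x y))"
  have [simp]: "cmod c = 1"
    using False by (simp add: c_def norm_divide)
  have "cinner x (c *\<^sub>C y) = of_real (cmod (cinner x y))"
    using False complex_norm_square[of "cinner x y"]
    by (simp add: cinner_scaleC_right c_def field_simps power2_eq_square)
  then have "cmod (cinner x y) = inner x (c *\<^sub>C y)"
    by (simp flip: Re_cinner)
  also have "\<dots> \<le> norm x * norm (c *\<^sub>C y)"
    by (rule norm_cauchy_schwarz)
  finally show ?thesis
    by simp
qed simp

lemma norm_coef_le: "cmod (coef x k) \<le> norm x"
proof -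
  have "(cmod (coef x k))\<^sup>2 = (\<Sum>j\<in>{k}. (cmod (coef x j))\<^sup>2)"
    by simp
  also have "\<dots> \<le> (norm x)\<^sup>2"
    by (rule finite_sum_le_has_sum[OF norm_has_sum]) auto
  finally show ?thesis
    by (simp add: power2_le_iff_abs_le)
qed

lemma bounded_linear_coef: "bounded_linear (\<lambda>x. coef x k)"
  by (rule bounded_linear_intro[where K = 1]) (auto simp: norm_coef_le scaleR_conv_of_real)

lemma bounded_bilinear_scaleC: "bounded_bilinear scaleC"
proof
  show "\<exists>K. \<forall>a b. norm (a *\<^sub>C b) \<le> norm a * norm b * K"
    by (intro exI[of _ 1]) simp
qed (rule ell2_eqI, simp add: algebra_simps scaleR_conv_of_real)+

lemma bounded_bilinear_cinner: "bounded_bilinear cinner"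
proof
  show "\<exists>K. \<forall>a b. norm (cinner a b) \<le> norm a * norm b * K"
    by (intro exI[of _ 1]) (simp add: norm_cinner_le)
qed (simp_all add: cinner_add_left cinner_add_right cinner_scaleC_left cinner_scaleC_right
       scaleR_scaleC[where 'a='a] scaleR_conv_of_real)

lemmas continuous_on_cinner [continuous_intros] =
  bounded_bilinear.continuous_on[OF bounded_bilinear_cinner]
lemmas continuous_on_scaleC [continuous_intros] =
  bounded_bilinear.continuous_on[OF bounded_bilinear_scaleC]

instance ell2 :: (type) banach
proof
  fix X :: "nat \<Rightarrow> 'a ell2"
  assume X: "Cauchy X"
  have "Cauchy (\<lambda>n. coef (X n) k)" for k
    by (rule bounded_linear.Cauchy[OF bounded_linear_coef X])
  then obtain l where l: "(\<lambda>n. coef (X n) k) \<longlonglongrightarrow> l k" for k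
    unfolding Cauchy_convergent_iff convergent_def by metis
  \<comment> \<open>A Cauchy bound passes to the coordinatewise limit on each finite index set
    \<open>F\<close>, uniformly in \<open>F\<close>. This one estimate gives both square-summability
    of \<open>l\<close> and convergence in norm.\<close>
  have fin: "(\<Sum>k\<in>F. (cmod (coef (X n) k - l k))\<^sup>2) \<le> e\<^sup>2"
    if N: "\<And>m n. m \<ge> N \<Longrightarrow> n \<ge> N \<Longrightarrow> norm (X m - X n) < e" and F: "finite F" and n: "n \<ge> N"
    for F N n and e :: real
  proof (rule tendsto_upperbound)
    show "((\<lambda>m. \<Sum>k\<in>F. (cmod (coef (X n) k - coef (X m) k))\<^sup>2) \<longlongrightarrow>
        (\<Sum>k\<in>F. (cmod (coef (X n) k - l k))\<^sup>2)) sequentially"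
      by (intro tendsto_intros l)
    show "\<forall>\<^sub>F m in sequentially. (\<Sum>k\<in>F. (cmod (coef (X n) k - coef (X m) k))\<^sup>2) \<le> e\<^sup>2"
    proof (rule eventually_sequentiallyI)
      fix m assume m: "m \<ge> N"
      have "(\<Sum>k\<in>F. (cmod (coef (X n) k - coef (X m) k))\<^sup>2) =
          (\<Sum>k\<in>F. (cmod (coef (X n - X m) k))\<^sup>2)"
        by simp
      also have "\<dots> \<le> (norm (X n - X m))\<^sup>2"
        by (rule finite_sum_le_has_sum[OF norm_has_sum]) (use F in auto)
      also have "\<dots> \<le> e\<^sup>2"
        by (rule power_mono) (use N[OF n m] in auto)
      finally show "(\<Sum>k\<in>F. (cmod (coef (X n) k - coef (X m) k))\<^sup>2) \<le> e\<^sup>2" .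
    qed
  qed auto
  have sq: "square_summable (\<lambda>k. coef (X n) k - l k)"
    if N: "\<And>m n. m \<ge> N \<Longrightarrow> n \<ge> N \<Longrightarrow> norm (X m - X n) < e" and n: "n \<ge> N"
    for N n and e :: real
    unfolding square_summable_def
    by (rule nonneg_bdd_above_summable_on) (auto intro!: bdd_aboveI2 fin[OF N] n)
  obtain N0 where N0: "\<And>m n. m \<ge> N0 \<Longrightarrow> n \<ge> N0 \<Longrightarrow> norm (X m - X n) < 1"
    using X unfolding Cauchy_iff by (metis zero_less_one)
  have "square_summable (\<lambda>k. coef (X N0) k + (-1) * (coef (X N0) k - l k))"
    by (intro square_summable_add square_summable_mult square_summable_coef sq[OF N0]) auto
  then have l_sq: "square_summable l"
    by simp
  have "X \<longlonglongrightarrow> Abs_ell2 l"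
  proof (rule LIMSEQ_I)
    fix e :: real assume e: "e > 0"
    obtain N where N: "\<And>m n. m \<ge> N \<Longrightarrow> n \<ge> N \<Longrightarrow> norm (X m - X n) < e / 2"
      using X e unfolding Cauchy_iff by (metis half_gt_zero)
    have "norm (X n - Abs_ell2 l) < e" if n: "n \<ge> N" for n
    proof -
      have c: "coef (X n - Abs_ell2 l) k = coef (X n) k - l k" for k
        using l_sq by (simp add: Abs_ell2_inverse)
      have "(norm (X n - Abs_ell2 l))\<^sup>2 \<le> (e / 2)\<^sup>2"
      proof (rule has_sum_le_finite_sums[OF norm_has_sum])
        show "(\<Sum>k\<in>F. (cmod (coef (X n - Abs_ell2 l) k))\<^sup>2) \<le> (e / 2)\<^sup>2"
          if "finite F" for F
          unfolding c by (rule fin[OF N that n])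
      qed
      then show ?thesis
        using e by (simp add: power2_le_iff_abs_le)
    qed
    then show "\<exists>N. \<forall>n\<ge>N. norm (X n - Abs_ell2 l) < e"
      by blast
  qed
  then show "convergent X"
    by (auto simp: convergent_def)
qed


section \<open>Closed subspaces and orthogonal projections\<close>

text \<open>A minimising sequence for the distance is Cauchy by the parallelogram law. Its limit is
  the foot of the perpendicular, since moving along any direction of \<open>S\<close> cannot shorten
  the distance.\<close>

lemma projection_exists:
  fixes S :: "'a :: {real_inner, banach} set"
  assumes S: "subspace S" "closed S"
  shows "\<exists>y\<in>S. \<forall>s\<in>S. inner (x - y) s = 0"
proof -
  have ne: "S \<noteq> {}"
    using subspace_0[OF S(1)] by auto
  define d where "d = infdist x S"
  have d_le: "d \<le> norm (x - s)" if "s \<in> S" for s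
    using infdist_le[OF that, of x] by (simp add: d_def dist_norm)
  have d_nonneg: "d \<ge> 0"
    by (simp add: d_def infdist_nonneg)
  have "\<exists>s\<in>S. norm (x - s) < d + inverse (Suc n)" for n
  proof (rule ccontr)
    assume "\<not> ?thesis"
    then have "d + inverse (Suc n) \<le> dist x s" if "s \<in> S" for s
      using that by (force simp: dist_norm not_less)
    then have "d + inverse (Suc n) \<le> (INF s\<in>S. dist x s)"
      by (intro cINF_greatest ne)
    then show False
      using ne by (simp add: d_def infdist_def)
  qed
  then obtain s where s: "\<And>n. s n \<in> S" "\<And>n. norm (x - s n) < d + inverse (Suc n)"
    by metis
  \<comment> \<open>The parallelogram bound: midpoints stay in \<open>S\<close>, hence at distance
    at least \<open>d\<close> from \<open>x\<close>.\<close>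
  define g where "g n = 4 * (d + inverse (Suc n))\<^sup>2 - 4 * d\<^sup>2" for n :: nat
  have close: "(norm (s m - s n))\<^sup>2 \<le> g N" if "m \<ge> N" "n \<ge> N" for m n N
  proof -
    have *: "(norm (x - s k))\<^sup>2 \<le> (d + inverse (Suc N))\<^sup>2" if "k \<ge> N" for k
    proof (rule power_mono)
      have "inverse (real (Suc k)) \<le> inverse (Suc N)"
        using that by (simp add: field_simps)
      then show "norm (x - s k) \<le> d + inverse (Suc N)"
        using s(2)[of k] by linarith
    qed auto
    have "(1/2) *\<^sub>R (s m + s n) \<in> S"
      using S s by (simp add: subspace_add subspace_scale)
    then have "d\<^sup>2 \<le> (norm (x - (1/2) *\<^sub>R (s m + s n)))\<^sup>2"
      using d_le d_nonneg by (intro power_mono) auto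
    moreover have "(norm (s m - s n))\<^sup>2 = 2 * (norm (x - s m))\<^sup>2 + 2 * (norm (x - s n))\<^sup>2
        - 4 * (norm (x - (1/2) *\<^sub>R (s m + s n)))\<^sup>2"
      by (simp add: power2_norm_eq_inner inner_simps inner_commute field_simps)
    ultimately show ?thesis
      unfolding g_def using *[OF that(1)] *[OF that(2)] by linarith
  qed
  have "(\<lambda>n. 4 * (d + inverse (Suc n))\<^sup>2 - 4 * d\<^sup>2) \<longlonglongrightarrow> 4 * (d + 0)\<^sup>2 - 4 * d\<^sup>2"
    by (intro tendsto_intros LIMSEQ_inverse_real_of_nat)
  then have g0: "g \<longlonglongrightarrow> 0"
    by (simp add: g_def[abs_def])
  have "Cauchy s"
  proof (rule CauchyI)
    fix e :: real assume e: "e > 0"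
    then have "\<forall>\<^sub>F n in sequentially. g n < e\<^sup>2"
      by (intro order_tendstoD(2)[OF g0]) simp
    then obtain N where N: "g N < e\<^sup>2"
      by (auto simp: eventually_sequentially)
    have "norm (s m - s n) < e" if "m \<ge> N" "n \<ge> N" for m n
      using close[OF that] N e by (intro power2_less_imp_less[of _ e]) auto
    then show "\<exists>M. \<forall>m\<ge>M. \<forall>n\<ge>M. norm (s m - s n) < e"
      by blast
  qed
  then obtain y where y: "s \<longlonglongrightarrow> y"
    by (auto simp: Cauchy_convergent_iff convergent_def)
  have yS: "y \<in> S"
    using closed_sequentially[OF S(2) _ y] s(1) by auto
  have "(\<lambda>n. norm (x - s n)) \<longlonglongrightarrow> norm (x - y)"
    by (intro tendsto_intros y)
  moreover have "(\<lambda>n. d + inverse (Suc n)) \<longlonglongrightarrow> d + 0"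
    by (intro tendsto_intros LIMSEQ_inverse_real_of_nat)
  ultimately have "norm (x - y) \<le> d + 0"
    by (rule LIMSEQ_le) (use s(2) less_imp_le in blast)
  then have min: "norm (x - y) \<le> norm (x - t)" if "t \<in> S" for t
    using d_le[OF that] by simp
  have "inner (x - y) t = 0" if t: "t \<in> S" for t
  proof (cases "t = 0")
    case False
    define a where "a = inner (x - y) t"
    \<comment> \<open>The step length that minimises the distance to \<open>x\<close> along the line
      through \<open>y\<close> in direction \<open>t\<close>.\<close>
    define c where "c = a / (norm t)\<^sup>2"
    have "y + c *\<^sub>R t \<in> S"
      using S yS t by (simp add: subspace_add subspace_scale)
    then have "(norm (x - y))\<^sup>2 \<le> (norm ((x - y) - c *\<^sub>R t))\<^sup>2"
      using min by (intro power_mono) (auto simp: diff_diff_eq)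
    also have "\<dots> = (norm (x - y))\<^sup>2 - 2 * c * a + c\<^sup>2 * (norm t)\<^sup>2"
      unfolding a_def power2_norm_eq_inner inner_diff_left[of "x - y"]
        inner_diff_right[of _ "x - y"]
      by (simp add: inner_commute[of t "x - y"] power2_eq_square)
    also have "c\<^sup>2 * (norm t)\<^sup>2 = c * a"
      using False by (simp add: c_def power2_eq_square)
    finally have "c * a \<le> 0"
      by linarith
    then have "a\<^sup>2 \<le> 0"
      using False by (simp add: c_def divide_le_0_iff flip: power2_eq_square)
    then show ?thesis
      by (simp add: a_def)
  qed simp
  then show ?thesis
    using yS by blast
qed

global_interpretation ell2: vector_space scaleC
  by unfold_locales (rule ell2_eqI; simp add: algebra_simps)+

lemma subspace_ell2: "ell2.subspace R \<Longrightarrow> subspace R"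
  by (auto simp: subspace_def ell2.subspace_def scaleR_scaleC)

definition ell2_proj :: "'a ell2 set \<Rightarrow> 'a ell2 \<Rightarrow> 'a ell2" where
  "ell2_proj R x = (THE y. y \<in> R \<and> (\<forall>r\<in>R. cinner (x - y) r = 0))"

locale hilbert_subspace =
  fixes R :: "'a ell2 set"
  assumes sub: "ell2.subspace R" and cl: "closed R"
begin

lemmas R_add = ell2.subspace_add[OF sub]
  and R_diff = ell2.subspace_diff[OF sub] and R_scale = ell2.subspace_scale[OF sub]

lemma unique_ell2_proj:
  assumes "y \<in> R" "\<And>r. r \<in> R \<Longrightarrow> cinner (x - y) r = 0"
    "y' \<in> R" "\<And>r. r \<in> R \<Longrightarrow> cinner (x - y') r = 0"
  shows "y = y'"
proof -
  have "cinner (y - y') (y - y') = cinner (x - y') (y - y') - cinner (x - y) (y - y')"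
    by (simp flip: cinner_diff_left)
  also have "\<dots> = 0"
    using assms R_diff by simp
  finally show ?thesis
    by simp
qed

lemma ell2_proj_props: "ell2_proj R x \<in> R \<and> (\<forall>r\<in>R. cinner (x - ell2_proj R x) r = 0)"
proof -
  obtain y where y: "y \<in> R" "\<And>s. s \<in> R \<Longrightarrow> inner (x - y) s = 0"
    using projection_exists[OF subspace_ell2[OF sub] cl] by metis
  have orth: "cinner (x - y) r = 0" if "r \<in> R" for r
    using y(2)[OF that] y(2)[OF R_scale[OF that, of \<i>]]
    by (simp add: complex_eq_iff Im_cinner flip: Re_cinner)
  show ?thesis
    unfolding ell2_proj_def
    by (rule theI[of _ y]) (use y(1) orth unique_ell2_proj in blast)+
qed

lemma ell2_proj_in: "ell2_proj R x \<in> R"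
  and ell2_proj_orth: "r \<in> R \<Longrightarrow> cinner (x - ell2_proj R x) r = 0"
  using ell2_proj_props by blast+

lemma ell2_proj_eqI:
  assumes "y \<in> R" "\<And>r. r \<in> R \<Longrightarrow> cinner (x - y) r = 0"
  shows "ell2_proj R x = y"
  by (rule unique_ell2_proj[of _ x]) (use assms ell2_proj_in ell2_proj_orth in auto)

lemma ell2_proj_id: "x \<in> R \<Longrightarrow> ell2_proj R x = x"
  by (rule ell2_proj_eqI) auto

lemma cinner_ell2_proj_left: "r \<in> R \<Longrightarrow> cinner (ell2_proj R x) r = cinner x r"
  using ell2_proj_orth[of r x] by (simp add: cinner_diff_left)

lemma cinner_ell2_proj_right: "r \<in> R \<Longrightarrow> cinner r (ell2_proj R x) = cinner r x"
  by (metis cinner_commute cinner_ell2_proj_left)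

lemma ell2_proj_add: "ell2_proj R (x + y) = ell2_proj R x + ell2_proj R y"
  by (rule ell2_proj_eqI) (simp_all add: R_add ell2_proj_in cinner_diff_left cinner_add_left cinner_ell2_proj_left)

lemma ell2_proj_scaleC: "ell2_proj R (c *\<^sub>C x) = c *\<^sub>C ell2_proj R x"
  by (rule ell2_proj_eqI) (simp_all add: R_scale ell2_proj_in cinner_diff_left cinner_scaleC_left cinner_ell2_proj_left)

lemma ell2_proj_diff: "ell2_proj R (x - y) = ell2_proj R x - ell2_proj R y"
  by (rule ell2_proj_eqI) (simp_all add: R_diff ell2_proj_in cinner_diff_left cinner_ell2_proj_left)

lemma norm_ell2_proj_le: "norm (ell2_proj R x) \<le> norm x"
proof -
  have "(norm (ell2_proj R x))\<^sup>2 = cmod (cinner (ell2_proj R x) (ell2_proj R x))"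
    by (simp only: cinner_self norm_of_real) simp
  also have "\<dots> = cmod (cinner x (ell2_proj R x))"
    by (simp add: cinner_ell2_proj_left ell2_proj_in)
  also have "\<dots> \<le> norm x * norm (ell2_proj R x)"
    by (rule norm_cinner_le)
  finally show ?thesis
    by (cases "norm (ell2_proj R x) = 0") (auto simp: power2_eq_square mult_le_cancel_right)
qed

lemma bounded_linear_ell2_proj: "bounded_linear (ell2_proj R)"
  by (rule bounded_linear_intro[where K = 1])
    (auto simp: ell2_proj_add ell2_proj_scaleC scaleR_scaleC norm_ell2_proj_le)

text \<open>The remainder \<open>x - ell2_proj R x\<close> is itself an admissible \<open>y\<close>,
  so it is orthogonal to itself. Membership in \<open>R\<close> can thus be tested against the
  complement.\<close>

lemma orth_orth:
  assumes "\<And>y. (\<And>r. r \<in> R \<Longrightarrow> cinner y r = 0) \<Longrightarrow> cinner x y = 0"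
  shows "x \<in> R"
proof -
  have "cinner x (x - ell2_proj R x) = 0"
    by (rule assms) (rule ell2_proj_orth)
  moreover have "cinner (ell2_proj R x) (x - ell2_proj R x) = 0"
    using ell2_proj_orth[OF ell2_proj_in] cinner_eq_0_commute by blast
  ultimately have "cinner (x - ell2_proj R x) (x - ell2_proj R x) = 0"
    by (simp only: cinner_diff_left[of x]) simp
  then show ?thesis
    using ell2_proj_in[of x] by (simp add: eq_iff_diff_eq_0[symmetric])
qed

end


section \<open>Finite-dimensional subspaces\<close>

lemma norm_Pythagoras:
  assumes "cinner x y = 0"
  shows "(norm (x + y))\<^sup>2 = (norm x)\<^sup>2 + (norm y)\<^sup>2"
proof -
  have "inner x y = 0"
    using assms by (simp flip: Re_cinner)
  then show ?thesis
    by (simp add: power2_norm_eq_inner inner_simps inner_commute)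
qed

text \<open>A convergent sequence is bounded, so it stays in one of the compact pieces together with
  its limit. In the induction on spanning sets below, this supplies the closedness on which the next
  projection rests.\<close>

lemma closed_if_compact_cball:
  fixes V :: "'a :: real_normed_vector set"
  assumes "\<And>r. compact (V \<inter> cball 0 r)"
  shows "closed V"
proof (unfold closed_sequential_limits, intro allI impI, elim conjE)
  fix f l assume f: "\<forall>n. f n \<in> V" "f \<longlonglongrightarrow> l"
  obtain M where "\<And>n. norm (f n) \<le> M"
    using convergent_imp_bounded[OF f(2)] by (auto simp: bounded_iff)
  then have "\<forall>n. f n \<in> V \<inter> cball 0 M"
    using f(1) by auto
  then have "l \<in> V \<inter> cball 0 M"
    using closed_sequentially[OF compact_imp_closed[OF assms] _ f(2)] by blast
  then show "l \<in> V"
    by simp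
qed

lemma compact_span_cball:
  assumes "finite B"
  shows "compact (ell2.span B \<inter> cball (0 :: 'a ell2) r)"
  using assms
proof (induction B arbitrary: r rule: finite_induct)
  case empty
  have "ell2.span {} \<inter> cball (0 :: 'a ell2) r \<subseteq> {0}"
    by auto
  then show ?case
    by (meson finite.emptyI finite.insertI finite_imp_compact finite_subset)
next
  case (insert b B)
  define V where "V = ell2.span B"
  have "closed V"
    unfolding V_def by (rule closed_if_compact_cball) (rule insert.IH)
  then interpret V: hilbert_subspace V
    by unfold_locales (auto simp: V_def)
  show ?case
  proof (cases "b \<in> V")
    case True
    then have "ell2.span (insert b B) = V"
      by (simp add: V_def ell2.span_redundant)
    then show ?thesis
      using insert.IH V_def by simp
  next
    case False
    \<comment> \<open>Only the component of \<open>b\<close> orthogonal to \<open>V\<close> is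
      added, so that Pythagoras bounds both the coefficient and the \<open>V\<close>-part of a
      vector by its norm.\<close>
    define b' where "b' = b - ell2_proj V b"
    have b'0: "b' \<noteq> 0"
      using False V.ell2_proj_in[of b] by (auto simp: b'_def)
    define h where "h = (\<lambda>(c, v). c *\<^sub>C b' + v)"
    \<comment> \<open>\<open>K\<close> is the compact set of all combinations obeying these two
      bounds. It may protrude from the ball, hence the intersection with \<open>cball 0 r\<close> on
      both sides.\<close>
    define K where "K = h ` (cball 0 (r / norm b') \<times> (V \<inter> cball 0 r))"
    have "compact K"
      unfolding K_def h_def case_prod_unfold
      by (intro compact_continuous_image compact_Times compact_cball continuous_intros)
        (use insert.IH in \<open>simp add: V_def\<close>)
    then have "compact (K \<inter> cball 0 r)"
      by (simp add: compact_Int_closed)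
    moreover have "ell2.span (insert b B) \<inter> cball 0 r = K \<inter> cball 0 r"
    proof (intro subset_antisym subsetI)
      fix x assume x: "x \<in> ell2.span (insert b B) \<inter> cball 0 r"
      then obtain c where c: "x - c *\<^sub>C b \<in> V"
        by (auto simp: V_def ell2.span_breakdown_eq)
      define v where "v = x - c *\<^sub>C b'"
      have "v = (x - c *\<^sub>C b) + c *\<^sub>C ell2_proj V b"
        by (rule ell2_eqI) (simp add: v_def b'_def algebra_simps)
      then have v: "v \<in> V"
        using c by (simp add: V.R_add V.R_scale V.ell2_proj_in)
      have x_eq: "x = c *\<^sub>C b' + v"
        by (simp add: v_def)
      have "cinner (c *\<^sub>C b') v = 0"
        using V.ell2_proj_orth[OF v] by (simp add: b'_def cinner_scaleC_left)
      then have pyth: "(norm x)\<^sup>2 = (cmod c * norm b')\<^sup>2 + (norm v)\<^sup>2"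
        by (simp add: x_eq norm_Pythagoras)
      have "cmod c * norm b' \<le> norm x"
        by (rule power2_le_imp_le) (simp_all add: pyth)
      moreover have "norm v \<le> norm x"
        by (rule power2_le_imp_le) (simp_all add: pyth)
      moreover have "norm x \<le> r"
        using x by simp
      ultimately have "cmod c \<le> r / norm b'" "norm v \<le> r" "norm x \<le> r"
        using b'0 by (simp_all add: pos_le_divide_eq)
      then show "x \<in> K \<inter> cball 0 r"
        using v x_eq unfolding K_def h_def by (intro IntI image_eqI[where x = "(c, v)"]) auto
    next
      fix x assume x: "x \<in> K \<inter> cball 0 r"
      then obtain c v where v: "v \<in> V" and x_eq: "x = c *\<^sub>C b' + v"
        by (auto simp: K_def h_def)
      have "x - c *\<^sub>C b = v - c *\<^sub>C ell2_proj V b"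
        by (rule ell2_eqI) (simp add: x_eq b'_def algebra_simps)
      also have "\<dots> \<in> V"
        using v by (simp add: V.R_diff V.R_scale V.ell2_proj_in)
      finally show "x \<in> ell2.span (insert b B) \<inter> cball 0 r"
        using x by (auto simp: V_def ell2.span_breakdown_eq)
    qed
    ultimately show ?thesis
      by simp
  qed
qed

lemma hilbert_subspace_span:
  fixes B :: "'a ell2 set"
  assumes "finite B"
  shows "hilbert_subspace (ell2.span B)"
proof
  show "closed (ell2.span B)"
    by (rule closed_if_compact_cball) (rule compact_span_cball[OF assms])
qed simp

lemma compact_closure_finite_rank:
  fixes T :: "'a ell2 \<Rightarrow> 'b ell2"
  assumes "bounded_linear T" "finite B" "T ` R \<subseteq> ell2.span B"
  shows "compact (closure (T ` {x \<in> R. norm x \<le> 1}))"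
proof -
  have "T ` {x \<in> R. norm x \<le> 1} \<subseteq> ell2.span B \<inter> cball 0 (onorm T)"
  proof
    fix y assume "y \<in> T ` {x \<in> R. norm x \<le> 1}"
    then obtain x where x: "x \<in> R" "norm x \<le> 1" "y = T x"
      by blast
    have "norm (T x) \<le> onorm T * norm x"
      by (rule onorm[OF assms(1)])
    also have "\<dots> \<le> onorm T"
      using x(2) onorm_pos_le[OF assms(1)] by (simp add: mult_left_le)
    finally show "y \<in> ell2.span B \<inter> cball 0 (onorm T)"
      using x assms(3) by auto
  qed
  moreover note compact_span_cball[OF assms(2), of "onorm T"]
  ultimately show ?thesis
    using closure_minimal[OF _ compact_imp_closed] compact_Int_closed[OF _ closed_closure]
    by (metis inf.absorb_iff2)
qed

lemma orthonormal_sequence: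
  fixes R :: "'a ell2 set"
  assumes R: "ell2.subspace R" and inf: "\<nexists>B. finite B \<and> R \<subseteq> ell2.span B"
  obtains h :: "nat \<Rightarrow> 'a ell2"
  where "\<And>n. h n \<in> R" "\<And>n. norm (h n) = 1" "\<And>m n. m \<noteq> n \<Longrightarrow> cinner (h m) (h n) = 0"
proof -
  define P where "P f n r \<longleftrightarrow> r \<in> R \<and> norm r = 1 \<and> (f ` {..<n} \<subseteq> R \<longrightarrow> (\<forall>m<n. cinner r (f m) = 0))"
    for f :: "nat \<Rightarrow> 'a ell2" and n r
  have "\<exists>r. P f n r" for f n
  proof (cases "f ` {..<n} \<subseteq> R")
    case True
    interpret V: hilbert_subspace "ell2.span (f ` {..<n})"
      by (rule hilbert_subspace_span) simp
    obtain x where x: "x \<in> R" "x \<notin> ell2.span (f ` {..<n})"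
      using inf by blast
    define y where "y = x - ell2_proj (ell2.span (f ` {..<n})) x"
    have "ell2_proj (ell2.span (f ` {..<n})) x \<in> R"
      using V.ell2_proj_in ell2.span_minimal[OF True R] by blast
    then have y: "y \<in> R" "y \<noteq> 0"
      using x V.ell2_proj_in[of x] ell2.subspace_diff[OF R] by (auto simp: y_def)
    have "cinner y (f m) = 0" if "m < n" for m
      using that by (auto simp: y_def intro!: V.ell2_proj_orth ell2.span_base)
    then have "P f n (of_real (1 / norm y) *\<^sub>C y)"
      unfolding P_def using y ell2.subspace_scale[OF R]
      by (auto simp: cinner_scaleC_left norm_divide)
    then show ?thesis
      by blast
  next
    case False
    obtain x where x: "x \<in> R" "x \<notin> ell2.span {}"
      using inf by blast
    then have "P f n (of_real (1 / norm x) *\<^sub>C x)"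
      unfolding P_def using False ell2.subspace_scale[OF R] by (auto simp: norm_divide)
    then show ?thesis
      by blast
  qed
  then have "\<exists>f. \<forall>n. P f n (f n)"
  proof (intro dependent_wellorder_choice)
    show "P f n r = P g n r" if "\<And>m. m < n \<Longrightarrow> f m = g m" for n r and f g :: "nat \<Rightarrow> 'a ell2"
      using that by (simp add: P_def image_subset_iff)
  qed blast
  then obtain f where f: "\<And>n. P f n (f n)"
    by blast
  then have "f n \<in> R" for n
    by (simp add: P_def)
  then have orth: "cinner (f n) (f m) = 0" if "m < n" for m n
    using f[of n] that by (auto simp: P_def)
  show ?thesis
  proof
    show "cinner (f m) (f n) = 0" if "m \<noteq> n" for m n
      using orth[of m n] orth[of n m] that cinner_eq_0_commute nat_neq_iff by blast
  qed (use f in \<open>auto simp: P_def\<close>)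
qed


section \<open>Shifts and compressions\<close>

lemma square_summable_reindex:
  assumes "square_summable x" "inj_on g A"
  shows "(\<lambda>k. (cmod (x (g k)))\<^sup>2) summable_on A"
proof -
  have "(\<lambda>k. (cmod (x k))\<^sup>2) summable_on g ` A"
    using assms(1) unfolding square_summable_def
    by (rule summable_on_subset_banach) simp
  then show ?thesis
    by (simp add: summable_on_reindex[OF assms(2)] o_def)
qed

lift_definition shift :: "'n \<Rightarrow> ('n \<Rightarrow> nat) ell2 \<Rightarrow> ('n \<Rightarrow> nat) ell2" is
  "\<lambda>i x k. if k i = 0 then 0 else x (k(i := k i - 1))"
proof -
  fix i :: 'n and x :: "('n \<Rightarrow> nat) \<Rightarrow> complex" assume x: "square_summable x"
  have "inj_on (\<lambda>k :: 'n \<Rightarrow> nat. k(i := k i - 1)) {k. k i \<noteq> 0}"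
  proof (rule inj_onI)
    fix k l :: "'n \<Rightarrow> nat"
    assume kl: "k \<in> {k. k i \<noteq> 0}" "l \<in> {k. k i \<noteq> 0}" "k(i := k i - 1) = l(i := l i - 1)"
    have "k j = l j" for j
      using fun_cong[OF kl(3), of j] kl(1,2) by (cases "j = i") auto
    then show "k = l"
      by blast
  qed
  from square_summable_reindex[OF x this] show
    "square_summable (\<lambda>k. if k i = 0 then 0 else x (k(i := k i - 1)))"
    unfolding square_summable_def
    by (rule summable_on_cong_neutral[THEN iffD1, rotated -1]) auto
qed

lemma inj_fun_upd_Suc: "inj (\<lambda>k. k(i := Suc (k i)))"
proof (rule injI)
  fix k l :: "'a \<Rightarrow> nat"
  assume kl: "k(i := Suc (k i)) = l(i := Suc (l i))"
  have "k j = l j" for j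
    using fun_cong[OF kl, of j] by (cases "j = i") auto
  then show "k = l"
    by blast
qed

lift_definition bshift :: "'n \<Rightarrow> ('n \<Rightarrow> nat) ell2 \<Rightarrow> ('n \<Rightarrow> nat) ell2" is
  "\<lambda>i x k. x (k(i := Suc (k i)))"
  using square_summable_reindex[OF _ inj_fun_upd_Suc] by (simp add: square_summable_def)

lemmas coef_shift = shift.rep_eq and coef_bshift = bshift.rep_eq

lemma bshift_shift [simp]: "bshift i (shift i x) = x"
  by (rule ell2_eqI) (simp add: coef_shift coef_bshift)

lemma cinner_shift_left: "cinner (shift i x) y = cinner x (bshift i y)"
proof -
  have "cinner (shift i x) y = (\<Sum>\<^sub>\<infinity>k\<in>range (\<lambda>k. k(i := Suc (k i))). coef (shift i x) k * cnj (coef y k))"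
    unfolding cinner_def
  proof (rule infsum_cong_neutral)
    fix k assume k: "k \<in> UNIV - range (\<lambda>k. k(i := Suc (k i)))"
    have "k i = 0"
    proof (rule ccontr)
      assume "k i \<noteq> 0"
      then have "k = (k(i := k i - 1))(i := Suc ((k(i := k i - 1)) i))"
        by simp
      then show False
        using k by blast
    qed
    then show "coef (shift i x) k * cnj (coef y k) = 0"
      by (simp add: coef_shift)
  qed auto
  also have "\<dots> = cinner x (bshift i y)"
    unfolding cinner_def by (subst infsum_reindex[OF inj_fun_upd_Suc]) (simp add: o_def coef_shift coef_bshift)
  finally show ?thesis .
qed

lemma cinner_shift_right: "cinner x (shift i y) = cinner (bshift i x) y"
  by (metis cinner_commute cinner_shift_left)

lemma cinner_shift_shift [simp]: "cinner (shift i x) (shift i y) = cinner x y"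
  by (simp add: cinner_shift_left)

lemma norm_shift [simp]: "norm (shift i x) = norm x"
  by (simp add: norm_ell2_def)

lemma norm_bshift_le: "norm (bshift i x) \<le> norm x"
proof -
  have "(norm (bshift i x))\<^sup>2 = cmod (cinner (bshift i x) (bshift i x))"
    by (simp only: cinner_self norm_of_real) simp
  also have "\<dots> = cmod (cinner x (shift i (bshift i x)))"
    by (simp add: cinner_shift_right)
  also have "\<dots> \<le> norm x * norm (bshift i x)"
    using norm_cinner_le[of x "shift i (bshift i x)"] by simp
  finally show ?thesis
    by (cases "norm (bshift i x) = 0") (auto simp: power2_eq_square mult_le_cancel_right)
qed

lemma shift_add: "shift i (x + y) = shift i x + shift i y"
  and shift_scaleC: "shift i (c *\<^sub>C x) = c *\<^sub>C shift i x"
  by (rule ell2_eqI; simp add: coef_shift)+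

lemma bshift_add: "bshift i (x + y) = bshift i x + bshift i y"
  and bshift_diff: "bshift i (x - y) = bshift i x - bshift i y"
  and bshift_scaleC: "bshift i (c *\<^sub>C x) = c *\<^sub>C bshift i x"
  by (rule ell2_eqI; simp add: coef_bshift)+

lemma bounded_linear_shift: "bounded_linear (shift i)"
  by (rule bounded_linear_intro[where K = 1]) (auto simp: shift_add shift_scaleC scaleR_scaleC)

lemma bounded_linear_bshift: "bounded_linear (bshift i)"
  by (rule bounded_linear_intro[where K = 1]) (auto simp: bshift_add bshift_scaleC scaleR_scaleC norm_bshift_le)

text \<open>The commutator \<open>[C_i, C_j*]\<close> with \<open>bshift j\<close> already in place
  of the adjoint. It is defined on all of \<open>ell2\<close>, where it is bounded and linear when
  \<open>R\<close> is a quotient subspace.\<close>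

definition compr_comm :: "('n \<Rightarrow> nat) ell2 set \<Rightarrow> 'n \<Rightarrow> 'n \<Rightarrow> ('n \<Rightarrow> nat) ell2 \<Rightarrow> ('n \<Rightarrow> nat) ell2" where
  "compr_comm R i j x = ell2_proj R (shift i (bshift j x)) - bshift j (ell2_proj R (shift i x))"

locale quotient_subspace = hilbert_subspace R for R :: "('n::finite \<Rightarrow> nat) ell2 set" +
  assumes shift_orth: "\<And>i x r. (\<And>r. r \<in> R \<Longrightarrow> cinner x r = 0) \<Longrightarrow> r \<in> R \<Longrightarrow> cinner (shift i x) r = 0"
begin

text \<open>Dual to the shift invariance of the complement, by \<open>orth_orth\<close>. It is the
  reason why the adjoint of a compression needs no projection.\<close>

lemma bshift_in:
  assumes "x \<in> R" shows "bshift i x \<in> R"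
proof (rule orth_orth)
  fix y assume "\<And>r. r \<in> R \<Longrightarrow> cinner y r = 0"
  then have "cinner (shift i y) x = 0"
    using assms by (rule shift_orth)
  then show "cinner (bshift i x) y = 0"
    by (metis cinner_eq_0_commute cinner_shift_left)
qed

lemma compr_comm_in: "x \<in> R \<Longrightarrow> compr_comm R i j x \<in> R"
  by (simp add: compr_comm_def R_diff ell2_proj_in bshift_in)

lemma compr_comm_adjoint:
  assumes "f \<in> R" "g \<in> R"
  shows "cinner (compr_comm R i j f) g = cinner f (compr_comm R j i g)"
proof -
  have "cinner (ell2_proj R (shift i (bshift j f))) g = cinner f (ell2_proj R (shift j (bshift i g)))"
    using assms by (simp add: cinner_ell2_proj_left cinner_ell2_proj_right cinner_shift_left cinner_shift_right)
  moreover have "cinner (bshift j (ell2_proj R (shift i f))) g = cinner f (bshift i (ell2_proj R (shift j g)))"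
  proof -
    have "cinner (bshift j (ell2_proj R (shift i f))) g = cinner (ell2_proj R (shift i f)) (ell2_proj R (shift j g))"
      by (simp add: cinner_shift_right[symmetric] cinner_ell2_proj_right ell2_proj_in)
    also have "\<dots> = cinner f (bshift i (ell2_proj R (shift j g)))"
      by (simp add: cinner_shift_left[symmetric] cinner_ell2_proj_left ell2_proj_in)
    finally show ?thesis .
  qed
  ultimately show ?thesis
    by (simp add: compr_comm_def cinner_diff_left cinner_diff_right)
qed

text \<open>\<open>[C_j, C_i*]\<close> is the adjoint of \<open>[C_i, C_j*]\<close>: pairing the
  latter, applied to \<open>compr_comm R j i x\<close>, with \<open>x\<close> yields the squared
  norm of \<open>compr_comm R j i x\<close>.\<close>

lemma compr_comm_eq_0_commute:
  assumes "\<And>x. x \<in> R \<Longrightarrow> compr_comm R i j x = 0" "x \<in> R"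
  shows "compr_comm R j i x = 0"
proof -
  have "cinner (compr_comm R i j (compr_comm R j i x)) x = cinner (compr_comm R j i x) (compr_comm R j i x)"
    using assms by (intro compr_comm_adjoint) (auto simp: compr_comm_in)
  then show ?thesis
    using assms compr_comm_in by simp
qed

lemma bounded_linear_compr_comm: "bounded_linear (compr_comm R i j)"
  unfolding compr_comm_def
  by (intro bounded_linear_sub bounded_linear_compose[OF bounded_linear_ell2_proj]
      bounded_linear_compose[OF bounded_linear_bshift] bounded_linear_compose[OF bounded_linear_shift]
      bounded_linear_bshift bounded_linear_shift)

lemma compr_comm_scaleC: "compr_comm R i j (c *\<^sub>C x) = c *\<^sub>C compr_comm R i j x"
  by (rule ell2_eqI) (simp add: compr_comm_def shift_scaleC bshift_scaleC ell2_proj_scaleC algebra_simps)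

end


section \<open>One variable\<close>

text \<open>The constant function 1, which is the reproducing kernel at the origin.\<close>

lift_definition e0 :: "('n \<Rightarrow> nat) ell2" is "\<lambda>k. if k = (\<lambda>_. 0) then 1 else 0"
proof -
  have "(\<lambda>k :: 'n \<Rightarrow> nat. 1 :: real) summable_on {\<lambda>_. 0}"
    by simp
  then show "square_summable (\<lambda>k :: 'n \<Rightarrow> nat. if k = (\<lambda>_. 0) then 1 else 0)"
    unfolding square_summable_def
    by (rule summable_on_cong_neutral[THEN iffD1, rotated -1]) auto
qed

lemma cinner_e0: "cinner x e0 = coef x (\<lambda>_. 0)"
proof -
  have "cinner x e0 = (\<Sum>\<^sub>\<infinity>k\<in>{\<lambda>_. 0}. coef x k)"
    unfolding cinner_def by (rule infsum_cong_neutral) (auto simp: e0.rep_eq)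
  then show ?thesis
    by simp
qed

lemma fun_upd_num1 [simp]: "(f :: 1 \<Rightarrow> 'a)(i := a) = (\<lambda>_. a)"
  by (rule ext) (metis fun_upd_same num1_eq1)

lemma fun_num1_eq: "(\<lambda>_. k 1) = (k :: 1 \<Rightarrow> 'a)"
  by (rule ext) (metis num1_eq1)

lemma ell2_num1_eqI:
  fixes x y :: "(1 \<Rightarrow> nat) ell2"
  assumes "\<And>n. coef x (\<lambda>_. n) = coef y (\<lambda>_. n)"
  shows "x = y"
proof (rule ell2_eqI)
  fix k :: "1 \<Rightarrow> nat"
  show "coef x k = coef y k"
    using assms[of "k 1"] by (simp only: fun_num1_eq)
qed

lemma coef_shift_num1: "coef (shift (i :: 1) x) (\<lambda>_. n) = (if n = 0 then 0 else coef x (\<lambda>_. n - 1))"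
  by (simp add: coef_shift)

lemma coef_bshift_num1: "coef (bshift (i :: 1) x) (\<lambda>_. n) = coef x (\<lambda>_. Suc n)"
  by (simp add: coef_bshift)

lemma shift_bshift_num1: "shift (i :: 1) (bshift i x) = x - coef x (\<lambda>_. 0) *\<^sub>C e0"
  by (rule ell2_num1_eqI) (auto simp: coef_shift_num1 coef_bshift_num1 e0.rep_eq fun_eq_iff)

section \<open>Iterated shifts and wandering vectors in one variable\<close>

lemma coef_shift_power: "coef ((shift (i :: 1) ^^ m) x) (\<lambda>_. n) = (if n < m then 0 else coef x (\<lambda>_. n - m))"
  by (induction m arbitrary: n) (auto simp: coef_shift_num1)

lemma coef_bshift_power: "coef ((bshift (i :: 1) ^^ m) x) (\<lambda>_. n) = coef x (\<lambda>_. n + m)"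
  by (induction m arbitrary: n) (auto simp: coef_bshift_num1)

lemma norm_shift_power [simp]: "norm ((shift i ^^ m) x) = norm x"
  by (induction m) auto

lemma cinner_shift_power_le:
  "a \<le> b \<Longrightarrow> cinner ((shift i ^^ a) x) ((shift i ^^ b) y) = cinner x ((shift i ^^ (b - a)) y)"
proof (induction a arbitrary: b)
  case (Suc a)
  then show ?case
    by (cases b) auto
qed simp

text \<open>The series represents the product of \<open>\<phi>\<close> and \<open>\<psi>\<close>,
  which for general Hardy functions may leave the Hardy space. Here the terms are pairwise
  orthogonal and the shift is isometric, so convergence reduces to square-summability of the
  coefficients of \<open>\<psi>\<close>.\<close>

lemma sums_orthogonal_shifts:
  fixes \<phi> \<psi> :: "(1 \<Rightarrow> nat) ell2"
  assumes \<phi>: "\<And>n. n > 0 \<Longrightarrow> cinner \<phi> ((shift i ^^ n) \<phi>) = 0"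
  shows "summable (\<lambda>k. coef \<psi> (\<lambda>_. k) *\<^sub>C (shift i ^^ k) \<phi>)"
proof -
  define f where "f k = coef \<psi> (\<lambda>_. k) *\<^sub>C (shift i ^^ k) \<phi>" for k
  have orth: "cinner ((shift i ^^ a) \<phi>) ((shift i ^^ b) \<phi>) = 0" if "a \<noteq> b" for a b
  proof (cases "a < b")
    case True
    then show ?thesis
      by (simp add: cinner_shift_power_le \<phi>)
  next
    case False
    then have "cinner ((shift i ^^ b) \<phi>) ((shift i ^^ a) \<phi>) = 0"
      using that by (simp add: cinner_shift_power_le \<phi>)
    then show ?thesis
      by (rule cinner_eq_0_commute[THEN iffD1])
  qed
  have pyth: "(norm (sum f A))\<^sup>2 = (\<Sum>k\<in>A. (cmod (coef \<psi> (\<lambda>_. k)))\<^sup>2) * (norm \<phi>)\<^sup>2" if "finite A" for A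
  proof -
    have "pairwise (\<lambda>a b. orthogonal (f a) (f b)) A"
      unfolding pairwise_def orthogonal_def
      by (simp add: f_def cinner_scaleC_left cinner_scaleC_right orth flip: Re_cinner)
    then have "(norm (sum f A))\<^sup>2 = (\<Sum>k\<in>A. (norm (f k))\<^sup>2)"
      by (rule norm_sum_Pythagorean[OF that])
    then show ?thesis
      by (simp add: f_def power_mult_distrib sum_distrib_right)
  qed
  have "inj (\<lambda>n. (\<lambda>_. n) :: 1 \<Rightarrow> nat)"
    by (auto intro!: injI dest: fun_cong)
  then have "(\<lambda>n. (cmod (coef \<psi> (\<lambda>_. n)))\<^sup>2) summable_on UNIV"
    by (rule square_summable_reindex[OF square_summable_coef])
  then have sm: "summable (\<lambda>n. (cmod (coef \<psi> (\<lambda>_. n)))\<^sup>2)"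
    by (rule summable_on_imp_summable)
  have "summable f"
    unfolding summable_Cauchy
  proof (intro allI impI)
    fix e :: real assume e: "e > 0"
    \<comment> \<open>The summand 1 covers \<open>\<phi> = 0\<close> and makes the final estimate
      strict.\<close>
    define d where "d = e\<^sup>2 / ((norm \<phi>)\<^sup>2 + 1)"
    have "d > 0"
      using e by (simp add: d_def add_nonneg_pos)
    then obtain N where N: "\<And>m n. m \<ge> N \<Longrightarrow> norm (\<Sum>k=m..<n. (cmod (coef \<psi> (\<lambda>_. k)))\<^sup>2) < d"
      using sm unfolding summable_Cauchy by blast
    have "norm (sum f {m..<n}) < e" if "m \<ge> N" for m n
    proof (rule power2_less_imp_less)
      have "(\<Sum>k=m..<n. (cmod (coef \<psi> (\<lambda>_. k)))\<^sup>2) < d"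
        using N[OF that, of n] by (simp add: sum_nonneg)
      then have "(norm (sum f {m..<n}))\<^sup>2 \<le> d * (norm \<phi>)\<^sup>2"
        by (subst pyth) (auto intro!: mult_right_mono)
      also have "\<dots> < e\<^sup>2"
      proof -
        have "d * (norm \<phi>)\<^sup>2 < d * ((norm \<phi>)\<^sup>2 + 1)"
          using \<open>d > 0\<close> by simp
        also have "(norm \<phi>)\<^sup>2 + 1 \<noteq> 0"
          by (smt (verit) zero_le_power2)
        then have "d * ((norm \<phi>)\<^sup>2 + 1) = e\<^sup>2"
          by (simp add: d_def)
        finally show ?thesis .
      qed
      finally show "(norm (sum f {m..<n}))\<^sup>2 < e\<^sup>2" .
    qed (use e in simp)
    then show "\<exists>N. \<forall>m\<ge>N. \<forall>n. norm (sum f {m..<n}) < e"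
      by blast
  qed
  then show ?thesis
    by (simp add: f_def[abs_def])
qed

text \<open>
  Multiplication by \<open>\<phi>\<close> and by \<open>\<psi>\<close> are isometric up to scaling with orthogonal ranges,
  and the product of \<open>\<phi>\<close> and \<open>\<psi>\<close> lies in both ranges.
\<close>

lemma wandering_orthogonal:
  fixes \<phi> \<psi> :: "(1 \<Rightarrow> nat) ell2"
  assumes \<phi>: "\<And>n. n > 0 \<Longrightarrow> cinner \<phi> ((shift i ^^ n) \<phi>) = 0"
    and \<psi>: "\<And>n. n > 0 \<Longrightarrow> cinner \<psi> ((shift i ^^ n) \<psi>) = 0"
    and \<phi>\<psi>: "\<And>n. cinner \<phi> ((shift i ^^ n) \<psi>) = 0" and \<psi>\<phi>: "\<And>n. cinner \<psi> ((shift i ^^ n) \<phi>) = 0"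
  shows "\<phi> = 0 \<or> \<psi> = 0"
proof -
  \<comment> \<open>The coefficients of the sum form a Cauchy product. Reading them as formal power
    series supplies commutativity, which identifies the two sums below, and the absence of zero
    divisors, which ends the proof.\<close>
  have conv: "\<exists>X. (\<lambda>k. coef b (\<lambda>_. k) *\<^sub>C (shift i ^^ k) a) sums X \<and>
      (\<forall>n. coef X (\<lambda>_. n) = fps_nth (Abs_fps (\<lambda>k. coef b (\<lambda>_. k)) * Abs_fps (\<lambda>k. coef a (\<lambda>_. k))) n)"
    if "\<And>n. n > 0 \<Longrightarrow> cinner a ((shift i ^^ n) a) = 0" for a b :: "(1 \<Rightarrow> nat) ell2"
  proof -
    have "summable (\<lambda>k. coef b (\<lambda>_. k) *\<^sub>C (shift i ^^ k) a)"
      using that by (rule sums_orthogonal_shifts)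
    then obtain X where X: "(\<lambda>k. coef b (\<lambda>_. k) *\<^sub>C (shift i ^^ k) a) sums X"
      by (auto simp: summable_def)
    have "coef X (\<lambda>_. n) = fps_nth (Abs_fps (\<lambda>k. coef b (\<lambda>_. k)) * Abs_fps (\<lambda>k. coef a (\<lambda>_. k))) n" for n
    proof (rule sums_unique2)
      show "(\<lambda>k. coef (coef b (\<lambda>_. k) *\<^sub>C (shift i ^^ k) a) (\<lambda>_. n)) sums coef X (\<lambda>_. n)"
        by (rule bounded_linear.sums[OF bounded_linear_coef X])
      have "(\<lambda>k. coef (coef b (\<lambda>_. k) *\<^sub>C (shift i ^^ k) a) (\<lambda>_. n)) sums
          (\<Sum>k\<in>{0..n}. coef (coef b (\<lambda>_. k) *\<^sub>C (shift i ^^ k) a) (\<lambda>_. n))"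
        by (rule sums_finite) (auto simp: coef_shift_power)
      also have "(\<Sum>k\<in>{0..n}. coef (coef b (\<lambda>_. k) *\<^sub>C (shift i ^^ k) a) (\<lambda>_. n)) =
          fps_nth (Abs_fps (\<lambda>k. coef b (\<lambda>_. k)) * Abs_fps (\<lambda>k. coef a (\<lambda>_. k))) n"
        unfolding fps_mult_nth by (intro sum.cong) (auto simp: coef_shift_power)
      finally show "(\<lambda>k. coef (coef b (\<lambda>_. k) *\<^sub>C (shift i ^^ k) a) (\<lambda>_. n)) sums
          fps_nth (Abs_fps (\<lambda>k. coef b (\<lambda>_. k)) * Abs_fps (\<lambda>k. coef a (\<lambda>_. k))) n" .
    qed
    then show ?thesis
      using X by blast
  qed
  define F where "F = Abs_fps (\<lambda>k. coef \<phi> (\<lambda>_. k))"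
  define G where "G = Abs_fps (\<lambda>k. coef \<psi> (\<lambda>_. k))"
  obtain X where X: "(\<lambda>k. coef \<psi> (\<lambda>_. k) *\<^sub>C (shift i ^^ k) \<phi>) sums X" "\<And>n. coef X (\<lambda>_. n) = fps_nth (G * F) n"
    unfolding F_def G_def using conv[OF \<phi>] by blast
  obtain Y where Y: "(\<lambda>k. coef \<phi> (\<lambda>_. k) *\<^sub>C (shift i ^^ k) \<psi>) sums Y" "\<And>n. coef Y (\<lambda>_. n) = fps_nth (F * G) n"
    unfolding F_def G_def using conv[OF \<psi>] by blast
  have orth: "cinner ((shift i ^^ a) \<phi>) ((shift i ^^ b) \<psi>) = 0" for a b
  proof (cases "a \<le> b")
    case True
    then show ?thesis
      by (simp add: cinner_shift_power_le \<phi>\<psi>)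
  next
    case False
    then have "cinner ((shift i ^^ b) \<psi>) ((shift i ^^ a) \<phi>) = 0"
      by (simp add: cinner_shift_power_le \<psi>\<phi>)
    then show ?thesis
      by (rule cinner_eq_0_commute[THEN iffD1])
  qed
  have X_orth: "cinner X ((shift i ^^ b) \<psi>) = 0" for b
  proof -
    have "(\<lambda>k. cinner (coef \<psi> (\<lambda>_. k) *\<^sub>C (shift i ^^ k) \<phi>) ((shift i ^^ b) \<psi>)) sums cinner X ((shift i ^^ b) \<psi>)"
      by (rule bounded_linear.sums[OF bounded_bilinear.bounded_linear_left[OF bounded_bilinear_cinner] X(1)])
    then have "(\<lambda>k. 0) sums cinner X ((shift i ^^ b) \<psi>)"
      by (simp add: cinner_scaleC_left orth)
    then show ?thesis
      using sums_zero sums_unique2 by blast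
  qed
  have "(\<lambda>k. cinner X (coef \<phi> (\<lambda>_. k) *\<^sub>C (shift i ^^ k) \<psi>)) sums cinner X Y"
    by (rule bounded_linear.sums[OF bounded_bilinear.bounded_linear_right[OF bounded_bilinear_cinner] Y(1)])
  then have "(\<lambda>k. 0) sums cinner X Y"
    by (simp add: cinner_scaleC_right X_orth)
  then have "cinner X Y = 0"
    using sums_zero sums_unique2 by blast
  moreover have "X = Y"
    by (rule ell2_num1_eqI) (simp add: X(2) Y(2) mult.commute)
  ultimately have "X = 0"
    by simp
  then have "G * F = 0"
    using X(2) by (simp add: fps_eq_iff)
  then consider "G = 0" | "F = 0"
    by auto
  then show ?thesis
  proof cases
    case 1
    then have "\<psi> = 0"
      by (intro ell2_num1_eqI) (simp add: G_def fps_eq_iff)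
    then show ?thesis ..
  next
    case 2
    then have "\<phi> = 0"
      by (intro ell2_num1_eqI) (simp add: F_def fps_eq_iff)
    then show ?thesis ..
  qed
qed

section \<open>The self-commutator of a one-variable quotient module\<close>

locale quotient_num1 = quotient_subspace R for R :: "(1 \<Rightarrow> nat) ell2 set"
begin

lemma compr_comm_eq:
  assumes "x \<in> R"
  shows "compr_comm R i i x = x - coef x (\<lambda>_. 0) *\<^sub>C ell2_proj R e0 - bshift i (ell2_proj R (shift i x))"
proof -
  have "ell2_proj R (shift i (bshift i x)) = x - coef x (\<lambda>_. 0) *\<^sub>C ell2_proj R e0"
    by (simp add: shift_bshift_num1 ell2_proj_diff ell2_proj_scaleC ell2_proj_id[OF assms])
  then show ?thesis
    by (simp add: compr_comm_def)
qed

lemma coef_0_eq_cinner_ell2_proj: "x \<in> R \<Longrightarrow> coef x (\<lambda>_. 0) = cinner x (ell2_proj R e0)"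
  by (simp add: cinner_ell2_proj_right cinner_e0)

text \<open>If \<open>f\<close> in \<open>R\<close> vanishes at the origin, the commutator at
  \<open>bshift i f\<close> reduces to a multiple of \<open>ell2_proj R e0\<close>, so
  \<open>bshift i f\<close> vanishes there as well. Iterating kills all Taylor coefficients of
  \<open>f\<close>: evaluation at the origin is injective on \<open>R\<close>.\<close>

lemma normal_imp_dim_le_1:
  assumes normal: "\<And>x. x \<in> R \<Longrightarrow> compr_comm R i i x = 0"
  shows "R \<subseteq> ell2.span {ell2_proj R e0}"
proof -
  define u where "u = ell2_proj R e0"
  have step: "bshift i f \<in> R \<and> coef (bshift i f) (\<lambda>_. 0) = 0" if f: "f \<in> R" "coef f (\<lambda>_. 0) = 0" for f
  proof (cases "u = 0")
    \<comment> \<open>Evaluation at the origin is the pairing with \<open>u\<close>, so all of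
      \<open>R\<close> vanishes there.\<close>
    case True
    then show ?thesis
      using coef_0_eq_cinner_ell2_proj bshift_in f by (simp add: u_def)
  next
    case False
    have "shift i (bshift i f) = f"
      unfolding shift_bshift_num1 using f(2) by (intro ell2_eqI) simp
    then have "compr_comm R i i (bshift i f) = bshift i f - coef (bshift i f) (\<lambda>_. 0) *\<^sub>C u - bshift i f"
      by (simp add: compr_comm_eq bshift_in f(1) ell2_proj_id u_def)
    then have "coef (bshift i f) (\<lambda>_. 0) *\<^sub>C u = 0"
      using normal[OF bshift_in[OF f(1)]] by simp
    then show ?thesis
      using False bshift_in[OF f(1)] by (simp add: ell2.scale_eq_0_iff)
  qed
  have zero: "f = 0" if f: "f \<in> R" "coef f (\<lambda>_. 0) = 0" for f
  proof -
    have "(bshift i ^^ n) f \<in> R \<and> coef ((bshift i ^^ n) f) (\<lambda>_. 0) = 0" for n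
      by (induction n) (use f step in auto)
    then show ?thesis
      by (intro ell2_num1_eqI) (simp add: coef_bshift_power)
  qed
  have "x \<in> ell2.span {u}" if x: "x \<in> R" for x
  proof (cases "u = 0")
    case True
    then show ?thesis
      using zero[OF x] coef_0_eq_cinner_ell2_proj[OF x] by (simp add: u_def ell2.span_zero)
  next
    case False
    have u: "u \<in> R"
      by (simp add: u_def ell2_proj_in)
    then have "coef u (\<lambda>_. 0) \<noteq> 0"
      using coef_0_eq_cinner_ell2_proj[OF u] False by (simp flip: u_def)
    then have "x - (coef x (\<lambda>_. 0) / coef u (\<lambda>_. 0)) *\<^sub>C u = 0"
      by (intro zero) (auto simp: R_diff R_scale x u)
    then show ?thesis
      by (metis eq_iff_diff_eq_0 ell2.span_base ell2.span_scale singletonI)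
  qed
  then show ?thesis
    by (auto simp: u_def)
qed

lemma compr_comm_finite_rank: "\<exists>B. finite B \<and> compr_comm R i i ` R \<subseteq> ell2.span B"
proof -
  \<comment> \<open>The wandering subspace: the vectors of the complement of \<open>R\<close> that
    are orthogonal to the shifted complement.\<close>
  define W where "W = {w. (\<forall>r\<in>R. cinner w r = 0) \<and>
    (\<forall>t. (\<forall>r\<in>R. cinner t r = 0) \<longrightarrow> cinner w (shift i t) = 0)}"
  have W_shift: "cinner w ((shift i ^^ n) t) = 0" if "w \<in> W" "t \<in> W" "n > 0" for w t n
  proof -
    have *: "\<forall>r\<in>R. cinner ((shift i ^^ m) t) r = 0" for m
      by (induction m) (use that(2) shift_orth in \<open>auto simp: W_def\<close>)
    show ?thesis
      using that(1,3) * by (cases n) (simp_all add: W_def)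
  qed
  have W_orth: "w = 0 \<or> t = 0" if "w \<in> W" "t \<in> W" "cinner w t = 0" for w t
  proof (rule wandering_orthogonal)
    have "cinner t w = 0"
      using that(3) by (rule cinner_eq_0_commute[THEN iffD1])
    then show "cinner w ((shift i ^^ n) t) = 0" "cinner t ((shift i ^^ n) w) = 0" for n
      using W_shift that by (cases "n = 0"; simp)+
  qed (use W_shift that in auto)
  have "\<exists>\<phi>. W \<subseteq> ell2.span {\<phi>}"
  proof (cases "W \<subseteq> {0}")
    case False
    then obtain \<phi> where \<phi>: "\<phi> \<in> W" "\<phi> \<noteq> 0"
      by blast
    have "w \<in> ell2.span {\<phi>}" if w: "w \<in> W" for w
    proof -
      define c where "c = cinner w \<phi> / cinner \<phi> \<phi>"
      have "w - c *\<^sub>C \<phi> \<in> W"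
        using w \<phi> by (simp add: W_def cinner_diff_left cinner_scaleC_left)
      moreover have "cinner (w - c *\<^sub>C \<phi>) \<phi> = 0"
        using \<phi> by (simp add: c_def cinner_diff_left cinner_scaleC_left)
      ultimately have "w - c *\<^sub>C \<phi> = 0"
        using W_orth \<phi> by blast
      then show ?thesis
        by (metis eq_iff_diff_eq_0 ell2.span_base ell2.span_scale singletonI)
    qed
    then show ?thesis
      by blast
  next
    case True
    then show ?thesis
      using ell2.span_zero by blast
  qed
  then obtain \<phi> where \<phi>: "W \<subseteq> ell2.span {\<phi>}"
    by blast
  have "compr_comm R i i x \<in> ell2.span {bshift i \<phi>, ell2_proj R e0}" if x: "x \<in> R" for x
  proof -
    \<comment> \<open>The part of \<open>shift i x\<close> that the projection discards. It is
      orthogonal to the shifted complement because the projected part lies in \<open>R\<close>, and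
      because the isometry of the shift reduces the pairing of \<open>shift i x\<close> with
      \<open>shift i t\<close> to that of \<open>x\<close> with \<open>t\<close>.\<close>
    define w where "w = shift i x - ell2_proj R (shift i x)"
    have "cinner w (shift i t) = 0" if t: "\<forall>r\<in>R. cinner t r = 0" for t
    proof -
      have "cinner (shift i t) (ell2_proj R (shift i x)) = 0"
        using t shift_orth ell2_proj_in by blast
      then have "cinner (ell2_proj R (shift i x)) (shift i t) = 0"
        by (rule cinner_eq_0_commute[THEN iffD1])
      moreover have "cinner x t = 0"
        using t x cinner_eq_0_commute by blast
      ultimately show ?thesis
        by (simp add: w_def cinner_diff_left)
    qed
    then have "w \<in> W"
      by (simp add: W_def) (simp add: w_def ell2_proj_orth)
    then obtain c where c: "w = c *\<^sub>C \<phi>"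
      using \<phi> by (auto simp: ell2.span_singleton)
    have "bshift i w = x - bshift i (ell2_proj R (shift i x))"
      by (simp add: w_def bshift_diff)
    then have "compr_comm R i i x = c *\<^sub>C bshift i \<phi> - coef x (\<lambda>_. 0) *\<^sub>C ell2_proj R e0"
      using compr_comm_eq[OF x, of i] by (simp add: c bshift_scaleC)
    then show ?thesis
      by (simp add: ell2.span_diff ell2.span_scale ell2.span_base)
  qed
  then show ?thesis
    by (intro exI[of _ "{bshift i \<phi>, ell2_proj R e0}"]) auto
qed

end


section \<open>Tensor products\<close>

text \<open>A finite set of multi-indices is contained in the box spanned by its coordinate
  projections, and over a box the sum factors. The product of the full sums is therefore a common
  bound.\<close>

lemma summable_on_prod_nonneg:
  fixes f :: "'n::finite \<Rightarrow> 'b \<Rightarrow> real"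
  assumes nonneg: "\<And>i k. f i k \<ge> 0" and sm: "\<And>i. f i summable_on UNIV"
  shows "(\<lambda>k. \<Prod>i\<in>UNIV. f i (k i)) summable_on UNIV"
proof (rule nonneg_bdd_above_summable_on)
  show "bdd_above (sum (\<lambda>k. \<Prod>i\<in>UNIV. f i (k i)) ` {F. F \<subseteq> UNIV \<and> finite F})"
  proof (rule bdd_aboveI2)
    fix F :: "('n \<Rightarrow> 'b) set" assume "F \<in> {F. F \<subseteq> UNIV \<and> finite F}"
    then have F: "finite F"
      by simp
    define G where "G i = (\<lambda>k. k i) ` F" for i
    have "(\<Sum>k\<in>F. \<Prod>i\<in>UNIV. f i (k i)) \<le> (\<Sum>k\<in>PiE UNIV G. \<Prod>i\<in>UNIV. f i (k i))"
      by (rule sum_mono2) (auto simp: G_def F intro!: finite_PiE prod_nonneg nonneg)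
    also have "\<dots> = (\<Prod>i\<in>UNIV. \<Sum>k\<in>G i. f i k)"
      by (subst prod_sum_PiE) (auto simp: G_def F)
    also have "\<dots> \<le> (\<Prod>i\<in>UNIV. infsum (f i) UNIV)"
      by (intro prod_mono conjI sum_nonneg nonneg finite_sum_le_infsum sm) (auto simp: G_def F nonneg)
    finally show "(\<Sum>k\<in>F. \<Prod>i\<in>UNIV. f i (k i)) \<le> (\<Prod>i\<in>UNIV. infsum (f i) UNIV)" .
  qed
qed (simp add: nonneg prod_nonneg)

lemma bij_const_num1: "bij (\<lambda>n. (\<lambda>_. n) :: 1 \<Rightarrow> 'a)"
  by (rule bijI') (auto simp: fun_eq_iff intro!: exI[of _ "_ 1"] dest: fun_cong)

lift_definition tensor :: "('n::finite \<Rightarrow> (1 \<Rightarrow> nat) ell2) \<Rightarrow> ('n \<Rightarrow> nat) ell2" is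
  "\<lambda>x k. \<Prod>i\<in>UNIV. x i (\<lambda>_. k i)"
proof -
  fix x :: "'n \<Rightarrow> (1 \<Rightarrow> nat) \<Rightarrow> complex"
  assume x: "\<And>i. square_summable (x i)"
  have "(\<lambda>n. (cmod (x i (\<lambda>_. n)))\<^sup>2) summable_on UNIV" for i
    by (rule square_summable_reindex[OF x bij_is_inj[OF bij_const_num1]])
  then show "square_summable (\<lambda>k. \<Prod>i\<in>UNIV. x i (\<lambda>_. k i))"
    unfolding square_summable_def prod_norm[symmetric] prod_power_distrib
    by (intro summable_on_prod_nonneg) auto
qed

lemmas coef_tensor = tensor.rep_eq

text \<open>The remaining product is free of \<open>x i\<close>, so linearity in one slot and the
  action of the shifts can be read off.\<close>

lemma coef_tensor_upd:
  "coef (tensor (x(i := y))) k = coef y (\<lambda>_. k i) * (\<Prod>j\<in>UNIV - {i}. coef (x j) (\<lambda>_. k j))"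
  unfolding coef_tensor by (subst prod.remove[of _ i]) (auto intro!: prod.cong)

lemma tensor_upd_add: "tensor (x(i := y + z)) = tensor (x(i := y)) + tensor (x(i := z))"
  and tensor_upd_diff: "tensor (x(i := y - z)) = tensor (x(i := y)) - tensor (x(i := z))"
  and tensor_upd_scaleC: "tensor (x(i := c *\<^sub>C y)) = c *\<^sub>C tensor (x(i := y))"
  and tensor_upd_0: "tensor (x(i := 0)) = 0"
  by (rule ell2_eqI; simp add: coef_tensor_upd algebra_simps)+

lemma tensor_eq_0: "x i = 0 \<Longrightarrow> tensor x = 0"
  using tensor_upd_0[of x i] by (simp add: fun_upd_idem)

lemma shift_tensor_upd: "shift i (tensor (x(i := y))) = tensor (x(i := shift 1 y))"
  by (rule ell2_eqI) (simp add: coef_tensor_upd coef_shift coef_shift_num1)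

lemma bshift_tensor_upd: "bshift i (tensor (x(i := y))) = tensor (x(i := bshift 1 y))"
  by (rule ell2_eqI) (simp add: coef_tensor_upd coef_bshift coef_bshift_num1)

lemma cinner_tensor: "cinner (tensor x) (tensor y) = (\<Prod>i\<in>UNIV. cinner (x i) (y i))"
proof -
  have reindex: "cinner (x i) (y i) = (\<Sum>\<^sub>\<infinity>n. coef (x i) (\<lambda>_. n) * cnj (coef (y i) (\<lambda>_. n)))" for i
    unfolding cinner_def by (rule infsum_reindex_bij_betw[OF bij_const_num1, symmetric])
  have "(\<lambda>n. norm (coef (x i) (\<lambda>_. n) * cnj (coef (y i) (\<lambda>_. n)))) summable_on UNIV" for i
    using cinner_abs_summable[of "x i" "y i"]
    by (rule summable_on_reindex_bij_betw[OF bij_const_num1, THEN iffD2])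
  then have "(\<Sum>\<^sub>\<infinity>k\<in>PiE UNIV (\<lambda>_. UNIV). \<Prod>i\<in>UNIV. coef (x i) (\<lambda>_. k i) * cnj (coef (y i) (\<lambda>_. k i))) =
      (\<Prod>i\<in>UNIV. cinner (x i) (y i))"
    unfolding reindex by (intro infsum_prod_PiE_abs) auto
  then show ?thesis
    by (simp add: cinner_def coef_tensor prod.distrib)
qed

lemma norm_tensor_sq: "(norm (tensor x))\<^sup>2 = (\<Prod>i\<in>UNIV. (norm (x i))\<^sup>2)"
proof -
  have "complex_of_real ((norm (tensor x))\<^sup>2) = of_real (\<Prod>i\<in>UNIV. (norm (x i))\<^sup>2)"
    using cinner_tensor[of x x] by (simp only: cinner_self of_real_prod)
  then show ?thesis
    by (simp only: of_real_eq_iff)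
qed

definition fdim :: "'a ell2 set \<Rightarrow> bool" where
  "fdim V \<longleftrightarrow> (\<exists>B. finite B \<and> V \<subseteq> ell2.span B)"

text \<open>Any two distinct members are \<open>sqrt (2 * K)\<close> apart, so no subsequence is
  Cauchy.\<close>

lemma not_compact_orthogonal_sequence:
  fixes v :: "nat \<Rightarrow> 'a ell2"
  assumes "compact S" "\<And>n. v n \<in> S" "K > 0" "\<And>n. (norm (v n))\<^sup>2 = K"
    "\<And>m n. m \<noteq> n \<Longrightarrow> cinner (v m) (v n) = 0"
  shows False
proof -
  obtain l r where r: "strict_mono r" "(v \<circ> r) \<longlonglongrightarrow> l"
    using assms(1,2) unfolding compact_def by metis
  then have "Cauchy (v \<circ> r)"
    by (simp add: LIMSEQ_imp_Cauchy)
  then obtain N where N: "\<And>m n. m \<ge> N \<Longrightarrow> n \<ge> N \<Longrightarrow> norm (v (r m) - v (r n)) < sqrt K"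
    using assms(3) unfolding Cauchy_iff o_def by (meson real_sqrt_gt_zero)
  have "r N \<noteq> r (Suc N)"
    using r(1) by (simp add: strict_mono_eq)
  then have "cinner (v (r N)) (- v (r (Suc N))) = 0"
    using assms(5) by (simp add: cinner_minus)
  then have "(norm (v (r N) + - v (r (Suc N))))\<^sup>2 = K + K"
    by (simp only: norm_Pythagoras) (simp add: assms(4))
  moreover have "(norm (v (r N) - v (r (Suc N))))\<^sup>2 < (sqrt K)\<^sup>2"
    by (intro power_strict_mono N) auto
  ultimately show False
    using assms(3) by simp
qed

section \<open>Tensor products of one-variable quotient modules\<close>

locale tensor_quotient = quotient_subspace R
  for R :: "('n::finite \<Rightarrow> nat) ell2 set" +
  fixes Rs :: "'n \<Rightarrow> (1 \<Rightarrow> nat) ell2 set"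
  assumes quotient_Rs: "\<And>i. quotient_num1 (Rs i)"
    and R_eq: "R = closure (ell2.span {tensor x |x. \<forall>i. x i \<in> Rs i})"
begin

sublocale Rs: quotient_num1 "Rs i" for i
  by (rule quotient_Rs)

lemma tensor_in: "(\<And>i. x i \<in> Rs i) \<Longrightarrow> tensor x \<in> R"
  unfolding R_eq by (intro closure_subset[THEN subsetD] ell2.span_base) blast

lemma orth_R:
  assumes y: "\<And>x. (\<And>i. x i \<in> Rs i) \<Longrightarrow> cinner y (tensor x) = 0" and r: "r \<in> R"
  shows "cinner y r = 0"
proof -
  let ?N = "{r. cinner y r = 0}"
  have "ell2.subspace ?N"
    by (simp add: ell2.subspace_def cinner_add_right cinner_scaleC_right)
  then have "ell2.span {tensor x |x. \<forall>i. x i \<in> Rs i} \<subseteq> ?N"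
    using y by (intro ell2.span_minimal) auto
  moreover have "closed ?N"
    by (intro closed_Collect_eq continuous_intros)
  ultimately have "R \<subseteq> ?N"
    unfolding R_eq by (rule closure_minimal)
  then show ?thesis
    using r by blast
qed

text \<open>Finite spans are closed, so their preimage under \<open>T\<close> is a closed subspace
  and elementary tensors decide. With \<open>T\<close> the identity this bounds the dimension of
  \<open>R\<close>; with \<open>B\<close> empty it shows that \<open>T\<close> vanishes on
  \<open>R\<close>.\<close>

lemma image_R_subset:
  assumes T: "bounded_linear T" "\<And>c x. T (c *\<^sub>C x) = c *\<^sub>C T x" and B: "finite B"
    and tensor: "\<And>x. (\<And>i. x i \<in> Rs i) \<Longrightarrow> T (tensor x) \<in> ell2.span B"
  shows "T ` R \<subseteq> ell2.span B"
proof -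
  interpret B: hilbert_subspace "ell2.span B"
    by (rule hilbert_subspace_span[OF B])
  let ?N = "{x. T x \<in> ell2.span B}"
  have "ell2.subspace ?N"
    by (simp add: ell2.subspace_def T(2) linear_add[OF bounded_linear.linear[OF T(1)]]
        linear_0[OF bounded_linear.linear[OF T(1)]]
        ell2.span_zero ell2.span_add ell2.span_scale)
  then have "ell2.span {tensor x |x. \<forall>i. x i \<in> Rs i} \<subseteq> ?N"
    using tensor by (intro ell2.span_minimal) auto
  then have "T ` ell2.span {tensor x |x. \<forall>i. x i \<in> Rs i} \<subseteq> ell2.span B"
    by blast
  then have "T ` closure (ell2.span {tensor x |x. \<forall>i. x i \<in> Rs i}) \<subseteq> ell2.span B"
    by (intro image_closure_subset B.cl bounded_linear.continuous_on[OF T(1)] continuous_on_id)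
  then show ?thesis
    by (simp add: R_eq)
qed

text \<open>All slots other than \<open>i\<close> already lie in their modules, so projecting slot
  \<open>i\<close> suffices: the inner product of the remainder with any tensor from
  \<open>R\<close> has a zero factor at \<open>i\<close>.\<close>

lemma ell2_proj_tensor_upd:
  assumes "\<And>j. x j \<in> Rs j"
  shows "ell2_proj R (tensor (x(i := y))) = tensor (x(i := ell2_proj (Rs i) y))"
proof (rule ell2_proj_eqI)
  show "tensor (x(i := ell2_proj (Rs i) y)) \<in> R"
    by (rule tensor_in) (use assms Rs.ell2_proj_in in auto)
  show "cinner (tensor (x(i := y)) - tensor (x(i := ell2_proj (Rs i) y))) r = 0" if "r \<in> R" for r
  proof (rule orth_R[OF _ that])
    fix z assume z: "\<And>j. z j \<in> Rs j"
    have "cinner (tensor (x(i := y - ell2_proj (Rs i) y))) (tensor z) = 0"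
      unfolding cinner_tensor using Rs.ell2_proj_orth[OF z] by (intro prod_zero) auto
    then show "cinner (tensor (x(i := y)) - tensor (x(i := ell2_proj (Rs i) y))) (tensor z) = 0"
      by (simp add: tensor_upd_diff)
  qed
qed

lemma compr_comm_tensor:
  assumes x: "\<And>j. x j \<in> Rs j"
  shows "compr_comm R i i (tensor x) = tensor (x(i := compr_comm (Rs i) 1 1 (x i)))"
proof -
  have shift: "shift i (tensor x) = tensor (x(i := shift 1 (x i)))"
    and bshift: "bshift i (tensor x) = tensor (x(i := bshift 1 (x i)))"
    using shift_tensor_upd[of i x "x i"] bshift_tensor_upd[of i x "x i"] by simp_all
  show ?thesis
    by (simp add: compr_comm_def shift bshift shift_tensor_upd bshift_tensor_upd ell2_proj_tensor_upd x tensor_upd_diff)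
qed

lemma fdim_R:
  assumes "\<And>i. fdim (Rs i)"
  shows "fdim R"
proof -
  obtain B where B: "\<And>i. finite (B i)" "\<And>i. Rs i \<subseteq> ell2.span (B i)"
    using assms unfolding fdim_def by metis
  define D where "D = tensor ` PiE UNIV B"
  have D: "finite D"
    by (simp add: D_def B finite_PiE)
  have "tensor x \<in> ell2.span D" if x: "\<And>i. x i \<in> Rs i" for x
  proof -
    have "\<exists>u. x i = (\<Sum>v\<in>B i. u v *\<^sub>C v)" for i
      using x[of i] B(2)[of i] ell2.span_finite[OF B(1), of i] by blast
    then obtain u where u: "\<And>i. x i = (\<Sum>v\<in>B i. u i v *\<^sub>C v)"
      by metis
    \<comment> \<open>Multilinear expansion over all choices of one generator per slot.\<close>
    have "tensor x = (\<Sum>g\<in>PiE UNIV B. (\<Prod>i\<in>UNIV. u i (g i)) *\<^sub>C tensor g)"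
      by (rule ell2_eqI) (simp add: coef_tensor u prod_sum_PiE B(1) flip: prod.distrib)
    also have "\<dots> \<in> ell2.span D"
      by (intro ell2.span_sum ell2.span_scale ell2.span_base) (simp add: D_def)
    finally show ?thesis .
  qed
  then have "(\<lambda>x. x) ` R \<subseteq> ell2.span D"
    by (intro image_R_subset D bounded_linear_ident) auto
  then show ?thesis
    using D by (auto simp: fdim_def)
qed

text \<open>One zero module would annihilate every elementary tensor.\<close>

lemma nontrivial_factors:
  assumes "\<not> fdim R"
  shows "\<exists>x\<in>Rs i. x \<noteq> 0"
proof (rule ccontr)
  assume triv: "\<not> ?thesis"
  have "(\<lambda>x. x) ` R \<subseteq> ell2.span {}"
  proof (intro image_R_subset bounded_linear_ident)
    fix x assume "\<And>j. x j \<in> Rs j"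
    then show "tensor x \<in> ell2.span {}"
      using triv tensor_eq_0[of x i] by simp
  qed auto
  then show False
    using assms unfolding fdim_def by (metis finite.emptyI image_ident)
qed

lemma compact_compr_comm_imp_compr_comm_eq_0:
  assumes comp: "compact (closure (compr_comm R j j ` {x \<in> R. norm x \<le> 1}))"
    and inf: "\<not> fdim (Rs i)" and ne: "j \<noteq> i" and nontriv: "\<not> fdim R" and g: "g \<in> Rs j"
  shows "compr_comm (Rs j) 1 1 g = 0"
proof (rule ccontr)
  assume w: "compr_comm (Rs j) 1 1 g \<noteq> 0"
  obtain e where e: "\<And>k. e k \<in> Rs k" "\<And>k. e k \<noteq> 0"
    using nontrivial_factors[OF nontriv] by metis
  obtain h :: "nat \<Rightarrow> (1 \<Rightarrow> nat) ell2" where h: "\<And>n. h n \<in> Rs i" "\<And>n. norm (h n) = 1"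
      "\<And>m n. m \<noteq> n \<Longrightarrow> cinner (h m) (h n) = 0"
    using orthonormal_sequence[OF Rs.sub, of i] inf unfolding fdim_def by metis
  \<comment> \<open>Slot \<open>j\<close> carries \<open>g\<close>, slot \<open>i\<close> the
    orthonormal sequence, and every other slot a fixed nonzero vector. The images
    \<open>tensor (y n)\<close> then have a common positive norm and inherit orthogonality from slot
    \<open>i\<close>.\<close>
  define x where "x n = e(j := g, i := h n)" for n
  define y where "y n = e(j := compr_comm (Rs j) 1 1 g, i := h n)" for n
  have x: "x n k \<in> Rs k" for n k
    by (simp add: x_def e g h)
  have xy: "compr_comm R j j (tensor (x n)) = tensor (y n)" for n
  proof -
    have "(x n)(j := compr_comm (Rs j) 1 1 (x n j)) = y n"
      using ne by (auto simp: x_def y_def fun_eq_iff)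
    then show ?thesis
      using compr_comm_tensor[of "x n" j, OF x] by simp
  qed
  define M where "M = norm (tensor (x 0))"
  have M: "norm (tensor (x n)) = M" for n
  proof -
    have "(norm (tensor (x n)))\<^sup>2 = M\<^sup>2"
      unfolding M_def norm_tensor_sq by (intro prod.cong) (auto simp: x_def h)
    then show ?thesis
      by (simp add: M_def)
  qed
  define K where "K = (norm (tensor (y 0)))\<^sup>2"
  have K: "(norm (tensor (y n)))\<^sup>2 = K" for n
    unfolding K_def norm_tensor_sq by (intro prod.cong) (auto simp: y_def h)
  have "h 0 \<noteq> 0"
    using h(2)[of 0] by auto
  then have "K > 0"
    unfolding K_def norm_tensor_sq using e w by (intro prod_pos) (auto simp: y_def)
  \<comment> \<open>Scales all test vectors into the unit ball at once; their common norm is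
    \<open>M\<close>.\<close>
  define r where "r = 1 / (1 + M)"
  have r: "r > 0"
    by (simp add: r_def M_def add_pos_nonneg)
  show False
  proof (rule not_compact_orthogonal_sequence[OF comp])
    fix n
    have "of_real r *\<^sub>C tensor (x n) \<in> {x \<in> R. norm x \<le> 1}"
      using r by (auto simp: R_scale tensor_in x M) (simp add: r_def M_def add_pos_nonneg field_simps)
    then have "compr_comm R j j (of_real r *\<^sub>C tensor (x n)) \<in> compr_comm R j j ` {x \<in> R. norm x \<le> 1}"
      by blast
    then show "of_real r *\<^sub>C tensor (y n) \<in> closure (compr_comm R j j ` {x \<in> R. norm x \<le> 1})"
      unfolding compr_comm_scaleC xy by (rule closure_subset[THEN subsetD])
    show "(norm (of_real r *\<^sub>C tensor (y n)))\<^sup>2 = r\<^sup>2 * K"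
      by (simp add: power_mult_distrib K)
  next
    show "0 < r\<^sup>2 * K"
      using r \<open>K > 0\<close> by simp
    show "cinner (of_real r *\<^sub>C tensor (y m)) (of_real r *\<^sub>C tensor (y n)) = 0" if "m \<noteq> n" for m n
    proof -
      have "cinner (tensor (y m)) (tensor (y n)) = 0"
        unfolding cinner_tensor by (rule prod_zero) (auto simp: y_def h(3)[OF that] intro: exI[of _ i])
      then show ?thesis
        by (simp add: cinner_scaleC_left cinner_scaleC_right)
    qed
  qed
qed

text \<open>On a line both the compression and its adjoint act as scalars, and scalars
  commute.\<close>

lemma compr_comm_eq_0_if_dim_1:
  assumes "Rs j = ell2.span {e}" "x \<in> Rs j"
  shows "compr_comm (Rs j) 1 1 x = 0"
proof -
  have e: "e \<in> Rs j"
    by (simp add: assms(1) ell2.span_base)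
  obtain c where c: "x = c *\<^sub>C e"
    using assms by (auto simp: ell2.span_singleton)
  obtain a where a: "bshift 1 e = a *\<^sub>C e"
    using Rs.bshift_in[OF e, of 1] unfolding assms(1) ell2.span_singleton by blast
  obtain b where b: "ell2_proj (Rs j) (shift 1 e) = b *\<^sub>C e"
    using Rs.ell2_proj_in[of j "shift 1 e"] unfolding assms(1) ell2.span_singleton by blast
  have "compr_comm (Rs j) 1 1 e = 0"
    by (simp add: compr_comm_def a b shift_scaleC bshift_scaleC Rs.ell2_proj_scaleC mult.commute)
  then show ?thesis
    by (simp add: c Rs.compr_comm_scaleC)
qed

theorem compact_compr_comm_iff:
  assumes off: "\<And>i j x. i \<noteq> j \<Longrightarrow> x \<in> R \<Longrightarrow> compr_comm R i j x = 0"
  shows "(\<forall>i j. compact (closure (compr_comm R i j ` {x \<in> R. norm x \<le> 1}))) \<longleftrightarrow>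
    fdim R \<or> (\<exists>i. \<not> fdim (Rs i) \<and> (\<forall>j. j \<noteq> i \<longrightarrow> (\<exists>e. e \<noteq> 0 \<and> Rs j = ell2.span {e})))"
    (is "?L \<longleftrightarrow> fdim R \<or> ?ii")
proof
  assume L: ?L
  show "fdim R \<or> ?ii"
  proof (rule disjCI)
    assume "\<not> ?ii"
    show "fdim R"
    proof (rule ccontr)
      assume nf: "\<not> fdim R"
      then obtain i where i: "\<not> fdim (Rs i)"
        using fdim_R by blast
      have "\<exists>e. e \<noteq> 0 \<and> Rs j = ell2.span {e}" if "j \<noteq> i" for j
      proof -
        have sub: "Rs j \<subseteq> ell2.span {ell2_proj (Rs j) e0}"
          by (rule Rs.normal_imp_dim_le_1) (rule compact_compr_comm_imp_compr_comm_eq_0[OF _ i that nf], use L in auto)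
        moreover have "ell2.span {ell2_proj (Rs j) e0} \<subseteq> Rs j"
          by (rule ell2.span_minimal) (simp_all add: Rs.ell2_proj_in Rs.sub)
        \<comment> \<open>Otherwise the inclusion just shown would make the factor
          \<open>Rs j\<close> zero.\<close>
        moreover have "ell2_proj (Rs j) e0 \<noteq> 0"
          using sub nontrivial_factors[OF nf, of j] by (auto simp: ell2.span_insert_0)
        ultimately show ?thesis
          by blast
      qed
      then show False
        using i \<open>\<not> ?ii\<close> by blast
    qed
  qed
next
  have finite_rank: "compact (closure (compr_comm R i j ` {x \<in> R. norm x \<le> 1}))"
    if "finite B" "compr_comm R i j ` R \<subseteq> ell2.span B" for i j B
    by (rule compact_closure_finite_rank[OF bounded_linear_compr_comm that])
  assume "fdim R \<or> ?ii"
  then show ?L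
  proof
    assume "fdim R"
    then obtain B where "finite B" "R \<subseteq> ell2.span B"
      by (auto simp: fdim_def)
    then show ?L
      using finite_rank[of B] compr_comm_in by blast
  next
    assume ?ii
    then obtain i where i: "\<And>j. j \<noteq> i \<Longrightarrow> \<exists>e. e \<noteq> 0 \<and> Rs j = ell2.span {e}"
      by blast
    then obtain e where e: "\<And>j. j \<noteq> i \<Longrightarrow> Rs j = ell2.span {e j}"
      by metis
    have "\<exists>B. finite B \<and> compr_comm R a b ` R \<subseteq> ell2.span B" for a b
    proof -
      consider "a \<noteq> b" | "a = b" "a \<noteq> i" | "a = i" "b = i"
        by blast
      then show ?thesis
      proof cases
        case 1
        then show ?thesis
          using off by (intro exI[of _ "{}"]) auto
      next
        case 2
        \<comment> \<open>The commutator acts in slot \<open>a\<close>, which ranges over a line,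
          and so creates a zero factor there.\<close>
        have "compr_comm R a b ` R \<subseteq> ell2.span {}"
          using 2 tensor_upd_0
          by (intro image_R_subset bounded_linear_compr_comm compr_comm_scaleC)
            (auto simp: compr_comm_tensor compr_comm_eq_0_if_dim_1[OF e])
        then show ?thesis
          by blast
      next
        case 3
        obtain C where C: "finite C" "compr_comm (Rs i) 1 1 ` Rs i \<subseteq> ell2.span C"
          using Rs.compr_comm_finite_rank by blast
        \<comment> \<open>Outside slot \<open>i\<close> the factors are lines, whose scalars can be
          pulled out of the tensor. What varies is the value of the one-variable commutator in slot
          \<open>i\<close>, and \<open>C\<close> spans these values; the entry \<open>e i\<close> is
          always overwritten.\<close>
        define D where "D = (\<lambda>y. tensor (e(i := y))) ` C"
        have "ell2.subspace {y. tensor (e(i := y)) \<in> ell2.span D}"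
          by (simp add: ell2.subspace_def tensor_upd_0 tensor_upd_add tensor_upd_scaleC ell2.span_zero
              ell2.span_add ell2.span_scale)
        then have "ell2.span C \<subseteq> {y. tensor (e(i := y)) \<in> ell2.span D}"
          by (intro ell2.span_minimal) (auto simp: D_def ell2.span_base)
        then have span_D: "tensor (e(i := compr_comm (Rs i) 1 1 y)) \<in> ell2.span D" if "y \<in> Rs i" for y
          using C that by blast
        have "compr_comm R i i ` R \<subseteq> ell2.span D"
        proof (intro image_R_subset bounded_linear_compr_comm compr_comm_scaleC)
          show "finite D"
            by (simp add: D_def C)
          fix x assume x: "\<And>j. x j \<in> Rs j"
          have "\<exists>c. x j = c *\<^sub>C e j" if "j \<noteq> i" for j
            using x[of j] e[OF that] by (auto simp: ell2.span_singleton)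
          then obtain c where c: "\<And>j. j \<noteq> i \<Longrightarrow> x j = c j *\<^sub>C e j"
            by metis
          have "tensor (x(i := y)) = (\<Prod>j\<in>UNIV - {i}. c j) *\<^sub>C tensor (e(i := y))" for y
            by (rule ell2_eqI) (simp add: coef_tensor_upd c prod.distrib)
          then show "compr_comm R i i (tensor x) \<in> ell2.span D"
            by (simp add: compr_comm_tensor x ell2.span_scale span_D)
        qed
        then show ?thesis
          using 3 C by (intro exI[of _ D]) (simp add: D_def)
      qed
    qed
    then show ?L
      using finite_rank by blast
  qed
qed

end


section \<open>The coefficient isomorphism\<close>

lemma powser_eq_0_imp:
  fixes g :: "nat \<Rightarrow> complex"
  assumes "\<And>w. cmod w < 1 \<Longrightarrow> (\<lambda>n. g n * w ^ n) sums 0"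
  shows "g n = 0"
proof (rule ccontr)
  assume n: "g n \<noteq> 0"
  have "g 0 = 0"
    using assms[of 0] by simp
  then have "n > 0"
    using n gr0I by metis
  \<comment> \<open>A power series with zero constant term and some nonzero coefficient has an
    isolated zero at the origin. Its sum here is the zero function, so no such \<open>s\<close> can
    exist.\<close>
  obtain s where s: "s > 0" "\<And>z :: complex. z \<in> cball 0 s - {0} \<Longrightarrow> (0 :: complex) \<noteq> 0"
    by (rule powser_0_nonzero[of 1 0 g "\<lambda>_. 0" n]) (use assms n \<open>n > 0\<close> in auto)
  show False
    using s(2)[of "of_real s"] s(1) by simp
qed

text \<open>Induction on the set \<open>A\<close> of variables whose exponents are already fixed.\<close>

lemma power_series_eq_0_imp:
  fixes d :: "('n::finite \<Rightarrow> nat) \<Rightarrow> complex"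
  assumes "\<And>z. z \<in> polydisc \<Longrightarrow> ((\<lambda>k. d k * (\<Prod>i\<in>UNIV. (z $ i) ^ k i)) has_sum 0) UNIV"
  shows "d k = 0"
proof -
  have claim: "((\<lambda>k. d k * (\<Prod>i\<in>- A. (z $ i) ^ k i)) has_sum 0) {k. \<forall>i\<in>A. k i = m i}"
    if "z \<in> polydisc" for A z m
    using finite[of A] that
  proof (induction A arbitrary: z m rule: finite_induct)
    case empty
    then show ?case
      using assms by simp
  next
    case (insert j A)
    define K where "K n = {k. (\<forall>i\<in>A. k i = m i) \<and> k j = n}" for n
    define c where "c k = d k * (\<Prod>i\<in>- insert j A. (z $ i) ^ k i)" for k
    have has: "((\<lambda>k. c k * w ^ k j) has_sum 0) {k. \<forall>i\<in>A. k i = m i}" if w: "cmod w < 1" for w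
    proof -
      let ?z = "\<chi> i. if i = j then w else z $ i"
      have "?z \<in> polydisc"
        using insert.prems w by (simp add: polydisc_def)
      then have "((\<lambda>k. d k * (\<Prod>i\<in>- A. (?z $ i) ^ k i)) has_sum 0) {k. \<forall>i\<in>A. k i = m i}"
        by (rule insert.IH)
      moreover have "(\<Prod>i\<in>- A. (?z $ i) ^ k i) = w ^ k j * (\<Prod>i\<in>- insert j A. (z $ i) ^ k i)" for k
      proof -
        have A: "- A = insert j (- insert j A)"
          using insert.hyps by auto
        have "(\<Prod>i\<in>- A. (?z $ i) ^ k i) =
            (?z $ j) ^ k j * (\<Prod>i\<in>- insert j A. (?z $ i) ^ k i)"
          unfolding A by (rule prod.insert) auto
        also have "(\<Prod>i\<in>- insert j A. (?z $ i) ^ k i) = (\<Prod>i\<in>- insert j A. (z $ i) ^ k i)"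
          by (rule prod.cong) auto
        finally show ?thesis
          by simp
      qed
      ultimately show ?thesis
        by (simp add: c_def mult_ac)
    qed
    have "c summable_on K n" for n
    proof -
      \<comment> \<open>The hypothesis allows only values \<open>w\<close> inside the disc, so
        \<open>w = 1\<close> is out of reach. On \<open>K n\<close> the exponent of the variable
        \<open>j\<close> is constantly \<open>n\<close>, and multiplying by \<open>2 ^ n\<close>
        undoes the choice \<open>w = 1/2\<close>.\<close>
      have "(\<lambda>k. c k * (1/2) ^ k j) summable_on K n"
      proof (rule summable_on_subset_banach)
        show "(\<lambda>k. c k * (1/2) ^ k j) summable_on {k. \<forall>i\<in>A. k i = m i}"
          by (rule has_sum_imp_summable[OF has]) (simp add: norm_divide)
      qed (auto simp: K_def)
      then have "(\<lambda>k. c k * (1/2) ^ k j * 2 ^ n) summable_on K n"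
        by (rule summable_on_cmult_left)
      then show ?thesis
        by (rule summable_on_cong[THEN iffD1, rotated]) (auto simp: K_def field_simps)
    qed
    then obtain g where g: "\<And>n. (c has_sum g n) (K n)"
      unfolding summable_on_def by metis
    have "(\<lambda>n. g n * w ^ n) sums 0" if w: "cmod w < 1" for w
    proof -
      \<comment> \<open>Grouping the terms by the exponent of the variable \<open>j\<close> turns
        the sum into a power series in \<open>w\<close> with coefficients
        \<open>g n\<close>.\<close>
      have bij: "bij_betw snd (Sigma UNIV K) {k. \<forall>i\<in>A. k i = m i}"
        by (rule bij_betwI[of _ _ _ "\<lambda>k. (k j, k)"]) (auto simp: K_def)
      have "((\<lambda>p. c (snd p) * w ^ snd p j) has_sum 0) (Sigma UNIV K)"
        by (rule has_sum_reindex_bij_betw[OF bij, THEN iffD2, OF has[OF w]])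
      moreover have "((\<lambda>k. c (snd (n, k)) * w ^ snd (n, k) j) has_sum g n * w ^ n) (K n)" for n
        using has_sum_cmult_left[OF g, of "w ^ n"]
        by (rule has_sum_cong[THEN iffD1, rotated]) (auto simp: K_def)
      ultimately have "((\<lambda>n. g n * w ^ n) has_sum 0) UNIV"
        by (rule has_sum_SigmaD)
      then show ?thesis
        by (rule has_sum_imp_sums)
    qed
    then have "g (m j) = 0"
      by (rule powser_eq_0_imp)
    moreover have "K (m j) = {k. \<forall>i\<in>insert j A. k i = m i}"
      by (auto simp: K_def)
    ultimately show ?case
      using g[of "m j"] by (simp add: c_def[abs_def])
  qed
  have "{l. \<forall>i\<in>UNIV. l i = k i} = {k}"
    by auto
  moreover have "0 \<in> polydisc"
    by (simp add: polydisc_def)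
  ultimately have "(d has_sum 0) {k}"
    using claim[of 0 UNIV k] by simp
  then show ?thesis
    using has_sum_finite[of "{k}" d] has_sum_unique by fastforce
qed

lemma has_power_series_unique:
  fixes f :: "complex ^ 'n \<Rightarrow> complex"
  assumes "has_power_series f a" "has_power_series f b"
  shows "a = b"
proof
  fix k
  have "((\<lambda>k. (a k - b k) * (\<Prod>i\<in>UNIV. (z $ i) ^ k i)) has_sum 0) UNIV" if "z \<in> polydisc" for z
  proof -
    have "((\<lambda>k. a k * (\<Prod>i\<in>UNIV. (z $ i) ^ k i)) has_sum f z) UNIV"
      and "((\<lambda>k. b k * (\<Prod>i\<in>UNIV. (z $ i) ^ k i)) has_sum f z) UNIV"
      using assms that by (auto simp: has_power_series_def)
    from has_sum_add[OF this(1) has_sum_uminusI[OF this(2)]] show ?thesis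
      by (simp add: left_diff_distrib)
  qed
  from power_series_eq_0_imp[of "\<lambda>k. a k - b k", OF this] show "a k = b k"
    by simp
qed

text \<open>A product of geometric series with ratios below 1, which is the finiteness of the Szego
  kernel. It makes every square-summable coefficient family converge absolutely on the
  polydisc.\<close>

lemma monomial_square_summable:
  fixes z :: "complex ^ 'n"
  assumes "z \<in> polydisc"
  shows "square_summable (\<lambda>k :: 'n \<Rightarrow> nat. \<Prod>i\<in>UNIV. (z $ i) ^ k i)"
proof -
  have "(\<lambda>n. ((cmod (z $ i)) ^ n)\<^sup>2) summable_on UNIV" for i
  proof -
    have "(cmod (z $ i))\<^sup>2 < 1"
      using assms by (simp add: polydisc_def power_less_one_iff abs_square_less_1)
    then have "summable (\<lambda>n. norm (((cmod (z $ i))\<^sup>2) ^ n))"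
      by (simp add: summable_geometric)
    then have "(\<lambda>n. ((cmod (z $ i))\<^sup>2) ^ n) summable_on UNIV"
      by (rule norm_summable_imp_summable_on)
    then show ?thesis
      by (simp add: mult.commute flip: power_mult)
  qed
  then show ?thesis
    unfolding square_summable_def prod_norm[symmetric] prod_power_distrib norm_power
    by (intro summable_on_prod_nonneg) auto
qed

definition hardy_fun :: "('n \<Rightarrow> nat) ell2 \<Rightarrow> complex ^ 'n \<Rightarrow> complex" where
  "hardy_fun x z = (if z \<in> polydisc then \<Sum>\<^sub>\<infinity>k. coef x k * (\<Prod>i\<in>UNIV. (z $ i) ^ k i) else 0)"

lemma power_series_abs_summable:
  fixes z :: "complex ^ 'n"
  assumes "z \<in> polydisc"
  shows "(\<lambda>k. norm (coef x k * (\<Prod>i\<in>UNIV. (z $ i) ^ k i))) summable_on UNIV"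
proof -
  have "square_summable (\<lambda>k. cnj (\<Prod>i\<in>UNIV. (z $ i) ^ k i))"
    using monomial_square_summable[OF assms] unfolding square_summable_def complex_mod_cnj .
  from square_summable_mult_summable[OF square_summable_coef this] show ?thesis
    by simp
qed

lemma has_power_series_hardy_fun: "has_power_series (hardy_fun x) (coef x)"
  unfolding has_power_series_def
proof
  fix z :: "complex ^ 'a" assume "z \<in> polydisc"
  then show "((\<lambda>k. coef x k * (\<Prod>i\<in>UNIV. (z $ i) ^ k i)) has_sum hardy_fun x z) UNIV"
    using has_sum_infsum[OF abs_summable_summable[OF power_series_abs_summable]]
    by (simp add: hardy_fun_def)
qed

lemma hardy_fun_eqI:
  assumes "has_power_series f (coef x)" "\<And>z. z \<notin> polydisc \<Longrightarrow> f z = 0"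
  shows "f = hardy_fun x"
proof
  fix z
  show "f z = hardy_fun x z"
    using assms infsumI by (fastforce simp: hardy_fun_def has_power_series_def)
qed

lemma taylor_coeff_hardy_fun [simp]: "taylor_coeff (hardy_fun x) = coef x"
  unfolding taylor_coeff_def
  by (rule the_equality) (auto intro: has_power_series_hardy_fun has_power_series_unique)

lemma hinner_hardy_fun [simp]: "hinner (hardy_fun x) (hardy_fun y) = cinner x y"
  by (simp add: hinner_def cinner_def)

lemma hnorm_hardy_fun [simp]: "hnorm (hardy_fun x) = norm x"
  by (simp add: hnorm_def norm_ell2_def)

lemma inj_hardy_fun: "inj hardy_fun"
proof (rule injI)
  fix x y :: "('a \<Rightarrow> nat) ell2"
  assume "hardy_fun x = hardy_fun y"
  then have "coef x = coef y"
    by (metis taylor_coeff_hardy_fun)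
  then show "x = y"
    by (simp add: coef_inject)
qed

lemma hardy_fun_eq_iff [simp]: "hardy_fun x = hardy_fun y \<longleftrightarrow> x = y"
  using inj_hardy_fun by (auto dest: injD)

lemma range_hardy_fun: "range hardy_fun = (hardy :: (complex ^ 'n \<Rightarrow> complex) set)"
proof (intro subset_antisym subsetI)
  fix f :: "complex ^ 'n \<Rightarrow> complex"
  assume "f \<in> hardy"
  then obtain a where a: "has_power_series f a" "square_summable a" "\<And>z. z \<notin> polydisc \<Longrightarrow> f z = 0"
    by (auto simp: hardy_def square_summable_def)
  then have "f = hardy_fun (Abs_ell2 a)"
    by (intro hardy_fun_eqI) (simp_all add: Abs_ell2_inverse)
  then show "f \<in> range hardy_fun"
    by blast
next
  fix f :: "complex ^ 'n \<Rightarrow> complex"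
  assume "f \<in> range hardy_fun"
  then obtain x where f: "f = hardy_fun x"
    by blast
  show "f \<in> hardy"
    using has_power_series_hardy_fun[of x] square_summable_coef[of x]
    by (auto simp: f hardy_def square_summable_def) (simp add: hardy_fun_def)
qed

lemma hardyE:
  assumes "f \<in> hardy" obtains x where "f = hardy_fun x"
  using assms range_hardy_fun by blast

lemma hardy_fun_in_hardy [simp]: "hardy_fun x \<in> hardy"
  using range_hardy_fun by blast

lemma hardy_fun_add: "hardy_fun (x + y) = hardy_fun x + hardy_fun y"
proof (rule hardy_fun_eqI[symmetric])
  show "has_power_series (hardy_fun x + hardy_fun y) (coef (x + y))"
    using has_sum_add has_power_series_hardy_fun[of x] has_power_series_hardy_fun[of y]
    by (fastforce simp: has_power_series_def distrib_right)
qed (simp add: hardy_fun_def)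

lemma hardy_fun_scaleC: "hardy_fun (c *\<^sub>C x) = cscale c (hardy_fun x)"
proof (rule hardy_fun_eqI[symmetric])
  show "has_power_series (cscale c (hardy_fun x)) (coef (c *\<^sub>C x))"
    using has_power_series_hardy_fun[of x]
    by (auto simp: has_power_series_def cscale_def mult.assoc intro: has_sum_cmult_right)
qed (simp add: hardy_fun_def cscale_def)

lemma hardy_fun_diff: "hardy_fun (x - y) = hardy_fun x - hardy_fun y"
  using hardy_fun_add[of "x - y" y] by (simp add: algebra_simps)

lemma hardy_fun_0: "hardy_fun 0 = 0"
  using hardy_fun_diff[of 0 0] by simp

interpretation hardy_fun: module_hom scaleC cscale hardy_fun
  by unfold_locales (simp_all add: hardy_fun_add hardy_fun_scaleC)

lemma mult_op_hardy_fun: "mult_op i (hardy_fun x) = hardy_fun (shift i x)"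
proof (rule hardy_fun_eqI)
  show "mult_op i (hardy_fun x) z = 0" if "z \<notin> polydisc" for z
    using that by (simp add: mult_op_def hardy_fun_def)
  show "has_power_series (mult_op i (hardy_fun x)) (coef (shift i x))"
    unfolding has_power_series_def
  proof
    fix z :: "complex ^ 'a" assume z: "z \<in> polydisc"
    let ?s = "\<lambda>k :: 'a \<Rightarrow> nat. k(i := Suc (k i))"
    let ?m = "\<lambda>k :: 'a \<Rightarrow> nat. \<Prod>i\<in>UNIV. (z $ i) ^ k i"
    have m: "?m (?s k) = z $ i * ?m k" for k
    proof -
      have "(\<Prod>j\<in>UNIV - {i}. (z $ j) ^ ?s k j) = (\<Prod>j\<in>UNIV - {i}. (z $ j) ^ k j)"
        by (rule prod.cong) auto
      then show ?thesis
        using prod.remove[of UNIV i "\<lambda>j. (z $ j) ^ ?s k j"] prod.remove[of UNIV i "\<lambda>j. (z $ j) ^ k j"]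
        by simp
    qed
    have "((\<lambda>k. coef x k * ?m k) has_sum hardy_fun x z) UNIV"
      using has_power_series_hardy_fun[of x] z unfolding has_power_series_def by blast
    then have "((\<lambda>k. z $ i * (coef x k * ?m k)) has_sum z $ i * hardy_fun x z) UNIV"
      by (rule has_sum_cmult_right)
    moreover have "(\<lambda>k. coef (shift i x) k * ?m k) \<circ> ?s = (\<lambda>k. z $ i * (coef x k * ?m k))"
      unfolding o_def m by (simp add: coef_shift mult_ac)
    ultimately have "(((\<lambda>k. coef (shift i x) k * ?m k) \<circ> ?s) has_sum mult_op i (hardy_fun x) z) UNIV"
      by (simp only: mult_op_def)
    then have "((\<lambda>k. coef (shift i x) k * ?m k) has_sum mult_op i (hardy_fun x) z) (range ?s)"
      by (rule has_sum_reindex[OF inj_fun_upd_Suc, THEN iffD2])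
    then show "((\<lambda>k. coef (shift i x) k * ?m k) has_sum mult_op i (hardy_fun x) z) UNIV"
    proof (rule has_sum_cong_neutral[THEN iffD1, rotated -1])
      fix k assume k: "k \<in> UNIV - range ?s"
      have "k i = 0"
      proof (rule ccontr)
        assume "k i \<noteq> 0"
        then have "k = ?s (k(i := k i - 1))"
          by simp
        then show False
          using k by blast
      qed
      then show "coef (shift i x) k * ?m k = 0"
        by (simp add: coef_shift)
    qed auto
  qed
qed

lemma elem_tensor_hardy_fun: "elem_tensor (\<lambda>i. hardy_fun (x i)) = hardy_fun (tensor x)"
proof
  fix z :: "complex ^ 'a"
  show "elem_tensor (\<lambda>i. hardy_fun (x i)) z = hardy_fun (tensor x) z"
  proof (cases "z \<in> polydisc")
    case True
    have v: "(vec (z $ i) :: complex ^ 1) \<in> polydisc" for i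
      using True by (simp add: polydisc_def)
    have abs: "(\<lambda>n. norm (coef (x i) (\<lambda>_. n) * (z $ i) ^ n)) summable_on UNIV" for i
      using power_series_abs_summable[OF v, of "x i" i]
        summable_on_reindex_bij_betw[OF bij_const_num1,
          of "\<lambda>k. norm (coef (x i) k * (\<Prod>j\<in>UNIV. (vec (z $ i) :: complex ^ 1) $ j ^ k j))"]
      by simp
    have "hardy_fun (x i) (vec (z $ i)) = (\<Sum>\<^sub>\<infinity>n. coef (x i) (\<lambda>_. n) * (z $ i) ^ n)" for i
      using infsum_reindex_bij_betw[OF bij_const_num1,
          of "\<lambda>k. coef (x i) k * (\<Prod>j\<in>UNIV. (vec (z $ i) :: complex ^ 1) $ j ^ k j)"]
      by (simp add: hardy_fun_def v)
    then have "elem_tensor (\<lambda>i. hardy_fun (x i)) z =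
        (\<Prod>i\<in>UNIV. \<Sum>\<^sub>\<infinity>n. coef (x i) (\<lambda>_. n) * (z $ i) ^ n)"
      by (simp add: elem_tensor_def)
    also have "\<dots> = (\<Sum>\<^sub>\<infinity>k\<in>PiE UNIV (\<lambda>_. UNIV). \<Prod>i\<in>UNIV. coef (x i) (\<lambda>_. k i) * (z $ i) ^ k i)"
      using abs by (intro infsum_prod_PiE_abs[symmetric]) auto
    also have "\<dots> = hardy_fun (tensor x) z"
      using True by (simp add: hardy_fun_def coef_tensor prod.distrib)
    finally show ?thesis .
  next
    case False
    \<comment> \<open>A point outside the polydisc has a coordinate outside the disc, where the
      corresponding factor is zero by convention.\<close>
    then obtain i where "(vec (z $ i) :: complex ^ 1) \<notin> polydisc"
      by (auto simp: polydisc_def)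
    then have "elem_tensor (\<lambda>i. hardy_fun (x i)) z = 0"
      by (auto simp: elem_tensor_def hardy_fun_def intro!: prod_zero)
    then show ?thesis
      using False by (simp add: hardy_fun_def)
  qed
qed

section \<open>Metric and topology of the Hardy space\<close>

lemma hardy_fun_dist: "hnorm (hardy_fun x - hardy_fun y) = dist x y"
  by (simp add: dist_norm flip: hardy_fun_diff)

text \<open>\<open>Metric_space\<close> asks for this on all functions, including those outside the
  Hardy space, where the series may diverge; \<open>infsum\<close> is then 0 by default.\<close>

lemma hnorm_nonneg: "hnorm f \<ge> 0"
proof -
  define t where "t k = taylor_coeff f k * cnj (taylor_coeff f k)" for k
  have "0 \<le> infsum t UNIV"
  proof (cases "t summable_on UNIV")
    case True
    then show ?thesis
      by (rule infsum_nonneg_complex) (simp add: t_def complex_mult_cnj less_eq_complex_def)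
  qed (simp add: infsum_not_exists)
  then show ?thesis
    by (simp add: hnorm_def hinner_def less_eq_complex_def t_def[abs_def])
qed

text \<open>
  For \<open>f\<close> without a power series, \<open>taylor_coeff f\<close> is the junk value \<open>The (\<lambda>_. False)\<close>,
  which is also the one for \<open>- f\<close>.
\<close>

lemma hnorm_uminus: "hnorm (- f) = hnorm f"
proof (cases "\<exists>a. has_power_series f a")
  case True
  then obtain a where a: "has_power_series f a"
    by blast
  then have b: "has_power_series (- f) (\<lambda>k. - a k)"
    using has_sum_uminusI by (fastforce simp: has_power_series_def)
  have "taylor_coeff f = a" "taylor_coeff (- f) = (\<lambda>k. - a k)"
    unfolding taylor_coeff_def using a b by (blast intro: has_power_series_unique)+
  then show ?thesis
    by (simp add: hnorm_def hinner_def)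
next
  case False
  moreover have "has_power_series f (\<lambda>k. - a k)" if "has_power_series (- f) a" for a
    using that has_sum_uminusI by (fastforce simp: has_power_series_def)
  ultimately have "has_power_series (- f) = (\<lambda>_. False)" "has_power_series f = (\<lambda>_. False)"
    by auto
  then show ?thesis
    by (simp add: hnorm_def hinner_def taylor_coeff_def)
qed

lemma Metric_space_hardy:
  "Metric_space (hardy :: (complex ^ 'n \<Rightarrow> complex) set) (\<lambda>f g. hnorm (f - g))"
proof
  fix f g h :: "complex ^ 'n \<Rightarrow> complex"
  show "0 \<le> hnorm (f - g)"
    by (rule hnorm_nonneg)
  show "hnorm (f - g) = hnorm (g - f)"
    using hnorm_uminus[of "f - g"] by simp
  show "hnorm (f - g) = 0 \<longleftrightarrow> f = g" if "f \<in> hardy" "g \<in> hardy"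
    using that hnorm_hardy_fun[of 0] by (auto elim!: hardyE simp: hardy_fun_dist hardy_fun_0)
  show "hnorm (f - h) \<le> hnorm (f - g) + hnorm (g - h)" if "f \<in> hardy" "g \<in> hardy" "h \<in> hardy"
    using that by (auto elim!: hardyE simp: hardy_fun_dist dist_triangle)
qed

text \<open>Balls correspond under the isometry, hence open sets do, and an injective quotient map
  is a homeomorphism. Closures, closedness and compactness can then be computed in
  \<open>ell2\<close>.\<close>

lemma homeomorphic_map_hardy_fun:
  "homeomorphic_map euclidean (hardy_topology :: (complex ^ 'n \<Rightarrow> complex) topology) hardy_fun"
proof -
  interpret M: Metric_space "hardy :: (complex ^ 'n \<Rightarrow> complex) set" "\<lambda>f g. hnorm (f - g)"
    by (rule Metric_space_hardy)
  have top: "topspace hardy_topology = (hardy :: (complex ^ 'n \<Rightarrow> complex) set)"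
    by (simp add: hardy_topology_def)
  have mball: "M.mball (hardy_fun x) r = hardy_fun ` ball x r" for x :: "('n \<Rightarrow> nat) ell2" and r
    by (auto simp: M.mball_def hardy_fun_dist elim!: hardyE)
  have "open (hardy_fun -` U) \<longleftrightarrow> openin hardy_topology U"
    if U: "U \<subseteq> hardy" for U :: "(complex ^ 'n \<Rightarrow> complex) set"
  proof -
    have "openin hardy_topology U \<longleftrightarrow> (\<forall>f\<in>U. \<exists>r>0. M.mball f r \<subseteq> U)"
      unfolding hardy_topology_def M.openin_mtopology using U by blast
    also have "\<dots> \<longleftrightarrow> (\<forall>x\<in>hardy_fun -` U. \<exists>r>0. M.mball (hardy_fun x) r \<subseteq> U)"
    proof -
      have "hardy_fun ` (hardy_fun -` U) = U"
        using U by (auto elim!: hardyE)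
      then have "(\<forall>f\<in>U. \<exists>r>0. M.mball f r \<subseteq> U) \<longleftrightarrow>
          (\<forall>f\<in>hardy_fun ` (hardy_fun -` U). \<exists>r>0. M.mball f r \<subseteq> U)"
        by simp
      then show ?thesis
        by blast
    qed
    also have "\<dots> \<longleftrightarrow> open (hardy_fun -` U)"
      unfolding mball open_contains_ball image_subset_iff_subset_vimage ..
    finally show ?thesis ..
  qed
  then have "quotient_map euclidean hardy_topology (hardy_fun :: ('n \<Rightarrow> nat) ell2 \<Rightarrow> _)"
    by (simp add: quotient_map_def top range_hardy_fun vimage_def)
  then show ?thesis
    by (simp add: homeomorphic_map_def inj_hardy_fun)
qed

lemma closure_of_hardy_fun: "hardy_topology closure_of (hardy_fun ` S) = hardy_fun ` closure S"
  using homeomorphic_map_closure_of[OF homeomorphic_map_hardy_fun, of S] by simp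

lemma closedin_hardy_fun: "closedin hardy_topology (hardy_fun ` S) \<longleftrightarrow> closed S"
  using homeomorphic_map_closedness_eq[OF homeomorphic_map_hardy_fun, of S] by simp

lemma compactin_hardy_fun: "compactin hardy_topology (hardy_fun ` S) \<longleftrightarrow> compact S"
  using homeomorphic_map_compactness_eq[OF homeomorphic_map_hardy_fun, of S] by simp

lemma subspace_hardy_fun: "cfun.subspace (hardy_fun ` V) \<longleftrightarrow> ell2.subspace V"
  by (simp add: cfun.subspace_def ell2.subspace_def inj_image_mem_iff[OF inj_hardy_fun]
      flip: hardy_fun_0 hardy_fun_add hardy_fun_scaleC)

lemma finite_dim_hardy_fun: "finite_dim (hardy_fun ` V) \<longleftrightarrow> fdim V"
proof
  assume "fdim V"
  then obtain B where "finite B" "V \<subseteq> ell2.span B"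
    by (auto simp: fdim_def)
  then have "finite (hardy_fun ` B)" "hardy_fun ` V \<subseteq> cfun.span (hardy_fun ` B)"
    by (auto simp: hardy_fun.span_image)
  then show "finite_dim (hardy_fun ` V)"
    unfolding finite_dim_def by blast
next
  assume "finite_dim (hardy_fun ` V)"
  then obtain B where B: "finite B" "hardy_fun ` V \<subseteq> cfun.span B"
    by (auto simp: finite_dim_def)
  \<comment> \<open>The spanning set \<open>B\<close> may contain functions outside the Hardy space,
    which have no preimage. A basis taken inside the image is finite by comparison with
    \<open>B\<close> and can be pulled back.\<close>
  obtain C where C: "C \<subseteq> hardy_fun ` V" "cfun.independent C" "hardy_fun ` V \<subseteq> cfun.span C"
    by (rule cfun.maximal_independent_subset)
  have "finite C"
    using cfun.independent_span_bound[OF B(1) C(2)] C(1) B(2) by blast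
  obtain D where D: "C = hardy_fun ` D"
    using C(1) by (meson subset_image_iff)
  have "finite D"
    using \<open>finite C\<close> by (simp add: D finite_image_iff inj_on_subset[OF inj_hardy_fun])
  moreover have "V \<subseteq> ell2.span D"
    using C(3) by (auto simp: D hardy_fun.span_image)
  ultimately show "fdim V"
    by (auto simp: fdim_def)
qed

text \<open>An infinite basis has \<open>card\<close> 0, so the value 1 is never a default and
  forces a singleton basis.\<close>

lemma dim_hardy_fun_eq_1:
  assumes "ell2.subspace V"
  shows "cfun.dim (hardy_fun ` V) = 1 \<longleftrightarrow> (\<exists>e. e \<noteq> 0 \<and> V = ell2.span {e})"
proof
  assume "cfun.dim (hardy_fun ` V) = 1"
  moreover obtain C where C: "C \<subseteq> hardy_fun ` V" "cfun.independent C" "hardy_fun ` V \<subseteq> cfun.span C"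
      "card C = cfun.dim (hardy_fun ` V)"
    by (rule cfun.basis_exists)
  ultimately obtain f where "C = {f}"
    by (auto simp: card_1_singleton_iff)
  then obtain e where e: "C = hardy_fun ` {e}" "e \<in> V"
    using C(1) by auto
  have "e \<noteq> 0"
    using C(2) by (auto simp: e hardy_fun_0 cfun.dependent_zero)
  moreover have "V \<subseteq> ell2.span {e}"
    using C(3) unfolding e hardy_fun.span_image by auto
  moreover have "ell2.span {e} \<subseteq> V"
    using e(2) assms by (intro ell2.span_minimal) auto
  ultimately show "\<exists>e. e \<noteq> 0 \<and> V = ell2.span {e}"
    by blast
next
  assume "\<exists>e. e \<noteq> 0 \<and> V = ell2.span {e}"
  then obtain e where e: "e \<noteq> 0" "V = ell2.span {e}"
    by blast
  have "hardy_fun e \<noteq> 0"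
    using e(1) hardy_fun_eq_iff[of e 0] by (simp only: hardy_fun_0) simp
  then have "cfun.independent {hardy_fun e}"
    by simp
  moreover have "cfun.span (hardy_fun ` {e}) = cfun.span (hardy_fun ` V)"
    by (simp only: hardy_fun.span_image e(2) ell2.span_span)
  ultimately show "cfun.dim (hardy_fun ` V) = 1"
    using cfun.dim_eq_card[of "{hardy_fun e}" "hardy_fun ` V"] by simp
qed

section \<open>Transfer of quotient modules and their operators\<close>

lemma orth_compl_hardy_fun: "orth_compl (hardy_fun ` V) = hardy_fun ` {x. \<forall>r\<in>V. cinner x r = 0}"
  by (auto simp: orth_compl_def simp flip: range_hardy_fun)

lemma quotient_module_fnD:
  assumes "quotient_module (hardy_fun ` V)"
  shows "quotient_subspace V"
proof
  show "ell2.subspace V" "closed V"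
    using assms by (simp_all add: quotient_module_def subspace_hardy_fun closedin_hardy_fun)
  fix i x r
  assume x: "\<And>r. r \<in> V \<Longrightarrow> cinner x r = 0" and r: "r \<in> V"
  have "mult_op i (hardy_fun x) \<in> orth_compl (hardy_fun ` V)"
    using assms x unfolding quotient_module_def orth_compl_hardy_fun by blast
  then have "hardy_fun (shift i x) \<in> hardy_fun ` {x. \<forall>r\<in>V. cinner x r = 0}"
    by (simp only: mult_op_hardy_fun orth_compl_hardy_fun)
  then show "cinner (shift i x) r = 0"
    using r by auto
qed

lemma quotient_module_hardy_fun_vimage:
  assumes "quotient_module Q"
  shows "Q = hardy_fun ` (hardy_fun -` Q)"
  using assms range_hardy_fun by (auto simp: quotient_module_def image_vimage_eq)

context quotient_subspace
begin

lemma proj_hardy_fun: "proj (hardy_fun ` R) (hardy_fun x) = hardy_fun (ell2_proj R x)"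
  unfolding proj_def
proof (rule the_equality)
  show "hardy_fun (ell2_proj R x) \<in> hardy_fun ` R \<and> hardy_fun x - hardy_fun (ell2_proj R x) \<in> orth_compl (hardy_fun ` R)"
    by (auto simp: orth_compl_hardy_fun ell2_proj_in ell2_proj_orth simp flip: hardy_fun_diff)
  fix g assume g: "g \<in> hardy_fun ` R \<and> hardy_fun x - g \<in> orth_compl (hardy_fun ` R)"
  then obtain y where y: "y \<in> R" "g = hardy_fun y"
    by blast
  have "ell2_proj R x = y"
    by (rule ell2_proj_eqI) (use g y in \<open>auto simp: orth_compl_hardy_fun simp flip: hardy_fun_diff\<close>)
  then show "g = hardy_fun (ell2_proj R x)"
    using y by simp
qed

lemma compression_hardy_fun: "compression (hardy_fun ` R) i (hardy_fun x) = hardy_fun (ell2_proj R (shift i x))"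
  by (simp add: compression_def mult_op_hardy_fun proj_hardy_fun)

text \<open>By \<open>bshift_in\<close> the backward shift of \<open>x\<close> is a candidate inside
  \<open>R\<close>; two candidates differ by a vector of \<open>R\<close> orthogonal to itself,
  which settles the definite description.\<close>

lemma adj_on_compression_hardy_fun:
  assumes "x \<in> R"
  shows "adj_on (hardy_fun ` R) (compression (hardy_fun ` R) i) (hardy_fun x) = hardy_fun (bshift i x)"
  unfolding adj_on_def
proof (rule the_equality)
  show "hardy_fun (bshift i x) \<in> hardy_fun ` R \<and> (\<forall>f\<in>hardy_fun ` R. hinner (compression (hardy_fun ` R) i f) (hardy_fun x) = hinner f (hardy_fun (bshift i x)))"
    using assms by (auto simp: bshift_in compression_hardy_fun cinner_ell2_proj_left cinner_shift_left)
  fix h assume h: "h \<in> hardy_fun ` R \<and> (\<forall>f\<in>hardy_fun ` R. hinner (compression (hardy_fun ` R) i f) (hardy_fun x) = hinner f h)"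
  then obtain y where y: "y \<in> R" "h = hardy_fun y"
    by blast
  have "cinner f (bshift i x) = cinner f y" if "f \<in> R" for f
    using h that assms by (auto simp: y(2) compression_hardy_fun cinner_ell2_proj_left cinner_shift_left)
  then have "cinner (bshift i x - y) (bshift i x - y) = 0"
    using y(1) assms by (subst cinner_diff_right) (simp add: R_diff bshift_in)
  then show "h = hardy_fun (bshift i x)"
    by (simp add: y)
qed

lemma commutator_hardy_fun:
  assumes "x \<in> R"
  shows "commutator (compression (hardy_fun ` R) i) (adj_on (hardy_fun ` R) (compression (hardy_fun ` R) j)) (hardy_fun x) =
    hardy_fun (compr_comm R i j x)"
  using assms
  by (simp add: commutator_def adj_on_compression_hardy_fun compression_hardy_fun ell2_proj_in compr_comm_def hardy_fun_diff)

lemma essentially_normal_hardy_fun: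
  "essentially_normal (hardy_fun ` R) \<longleftrightarrow>
    (\<forall>i j. compact (closure (compr_comm R i j ` {x \<in> R. norm x \<le> 1})))"
proof -
  have "commutator (compression (hardy_fun ` R) i) (adj_on (hardy_fun ` R) (compression (hardy_fun ` R) j)) `
      {f \<in> hardy_fun ` R. hnorm f \<le> 1} = hardy_fun ` compr_comm R i j ` {x \<in> R. norm x \<le> 1}" for i j
  proof -
    have "{f \<in> hardy_fun ` R. hnorm f \<le> 1} = hardy_fun ` {x \<in> R. norm x \<le> 1}"
      by auto
    then show ?thesis
      by (auto simp: commutator_hardy_fun image_image intro!: image_cong)
  qed
  then show ?thesis
    by (simp add: essentially_normal_def compact_op_on_def closure_of_hardy_fun compactin_hardy_fun)
qed

end

lemma tensor_space_hardy_fun: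
  "tensor_space (\<lambda>i. hardy_fun ` Rs i) = hardy_fun ` closure (ell2.span {tensor x |x. \<forall>i. x i \<in> Rs i})"
proof -
  have "{elem_tensor f |f. \<forall>i. f i \<in> hardy_fun ` Rs i} = hardy_fun ` {tensor x |x. \<forall>i. x i \<in> Rs i}"
  proof (intro subset_antisym subsetI)
    fix g assume "g \<in> {elem_tensor f |f. \<forall>i. f i \<in> hardy_fun ` Rs i}"
    then obtain f where f: "g = elem_tensor f" "\<forall>i. \<exists>x. x \<in> Rs i \<and> f i = hardy_fun x"
      by blast
    then obtain x where x: "\<And>i. x i \<in> Rs i" "\<And>i. f i = hardy_fun (x i)"
      by metis
    then have "f = (\<lambda>i. hardy_fun (x i))"
      by blast
    then show "g \<in> hardy_fun ` {tensor x |x. \<forall>i. x i \<in> Rs i}"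
      using x(1) by (auto simp: f(1) elem_tensor_hardy_fun)
  next
    fix g assume "g \<in> hardy_fun ` {tensor x |x. \<forall>i. x i \<in> Rs i}"
    then obtain x where x: "\<forall>i. x i \<in> Rs i" "g = hardy_fun (tensor x)"
      by blast
    show "g \<in> {elem_tensor f |f. \<forall>i. f i \<in> hardy_fun ` Rs i}"
      unfolding x(2) elem_tensor_hardy_fun[symmetric] using x(1) by blast
  qed
  then show ?thesis
    by (simp add: tensor_space_def hardy_fun.span_image closure_of_hardy_fun)
qed

theorem corollary3p3:
  fixes Q :: "(complex ^ 'n::{finite,linorder} \<Rightarrow> complex) set"
    and Qs :: "'n \<Rightarrow> (complex ^ 1 \<Rightarrow> complex) set"
  assumes "CARD('n) \<ge> 2"
    and "\<And>i. quotient_module (Qs i)"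
    and "Q = tensor_space Qs"
    and "quotient_module Q"
    and "doubly_commuting Q"
  shows "essentially_normal Q \<longleftrightarrow>
    finite_dim Q \<or>
    (\<exists>i. \<not> finite_dim (Qs i) \<and> (\<forall>j. j \<noteq> i \<longrightarrow> cfun.dim (Qs j) = 1))"
proof -
  define R where "R = hardy_fun -` Q"
  define Rs where "Rs i = hardy_fun -` Qs i" for i
  have Q: "Q = hardy_fun ` R"
    unfolding R_def using assms(4) by (rule quotient_module_hardy_fun_vimage)
  have Qs: "Qs i = hardy_fun ` Rs i" for i
    unfolding Rs_def using assms(2) by (rule quotient_module_hardy_fun_vimage)
  interpret R: quotient_subspace R
    using assms(4) unfolding Q by (rule quotient_module_fnD)
  have Rs: "quotient_subspace (Rs i)" for i
    using assms(2)[of i] unfolding Qs by (rule quotient_module_fnD)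
  \<comment> \<open>The tensor decomposition becomes an equation between subsets of
    \<open>ell2\<close> once the injective \<open>hardy_fun\<close> is cancelled.\<close>
  have "hardy_fun ` R = hardy_fun ` closure (ell2.span {tensor x |x. \<forall>i. x i \<in> Rs i})"
    using assms(3) tensor_space_hardy_fun[of Rs] by (simp add: Q Qs[abs_def])
  then have "R = closure (ell2.span {tensor x |x. \<forall>i. x i \<in> Rs i})"
    by (simp add: inj_image_eq_iff[OF inj_hardy_fun])
  then interpret tensor_quotient R Rs
    by (intro tensor_quotient.intro tensor_quotient_axioms.intro R.quotient_subspace_axioms
        quotient_num1.intro Rs)
  have lt: "compr_comm R i j x = 0" if "i < j" "x \<in> R" for i j x
  proof -
    have "hardy_fun (compr_comm R i j x) = 0"
      using assms(5) that by (simp add: doubly_commuting_def Q R.commutator_hardy_fun)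
    then show ?thesis
      by (metis hardy_fun_0 hardy_fun_eq_iff)
  qed
  have off: "compr_comm R i j x = 0" if "i \<noteq> j" "x \<in> R" for i j x
  proof (cases "i < j")
    case False
    then show ?thesis
      using that lt[of j i] by (intro R.compr_comm_eq_0_commute[of j i]) auto
  qed (use lt that in blast)
  have "essentially_normal Q \<longleftrightarrow> fdim R \<or>
      (\<exists>i. \<not> fdim (Rs i) \<and> (\<forall>j. j \<noteq> i \<longrightarrow> cfun.dim (hardy_fun ` Rs j) = 1))"
    unfolding Q R.essentially_normal_hardy_fun dim_hardy_fun_eq_1[OF Rs.sub]
    by (rule compact_compr_comm_iff) (rule off)
  then show ?thesis
    by (simp add: Q Qs finite_dim_hardy_fun)
qed

end
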